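(* Assume the Ultrapower Axiom. Suppose \(U_0\) and \(U_1\) are uniform ultrafilters. Then there is a unique canonical comparison of \(\langle U_0,U_1\rangle\).
   Context: For a countably complete ultrafilter \(U\), \(\mathrm{Ult}(V,U)\) is the transitive collapse of the ultrapower, \(j_U\) its embedding, \([\mathrm{id}]_U\) the class of the identity. A uniform ultrafilter is a countably complete ultrafilter \(U\) on \([\kappa]^n\) (the \(n\)-element subsets of an ordinal \(\kappa\)) with \(\kappa\) least such that \([\kappa]^n\in U\); \(\mathrm{sp}(U)=\kappa\). If \(j:M\to N\) is elementary (\(M\) a transitive model of ZFC) and \(a\) a finite set of ordinals in \(N\), the (uniform) \(M\)-ultrafilter derived from \(j\) using \(a\) is the unique \(U\) such that, with \(\delta\) the least ordinal of \(M\) with \(a\subseteq j(\delta)\), \(U=\{X\in M: X\subseteq[\delta]^{|a|},\ a\in j(X)\}\). A comparison of \(\langle U_0,U_1\rangle\) by internal ultrafilters is a pair \(\langle W_0,W_1\rangle\) with \(W_i\in\mathrm{Ult}(V,U_i)\) a countably complete ultrafilter in the sense of \(\mathrm{Ult}(V,U_i)\), \(\mathrm{Ult}(\mathrm{Ult}(V,U_0),W_0)=\mathrm{Ult}(\mathrm{Ult}(V,U_1),W_1)\) and \(j_{W_0}\circ j_{U_0}=j_{W_1}\circ j_{U_1}\). It is canonical if \(W_0\) is the \(\mathrm{Ult}(V,U_0)\)-ultrafilter derived from \(j_{W_0}:\mathrm{Ult}(V,U_0)\to\mathrm{Ult}(\mathrm{Ult}(V,U_0),W_0)\) using \(j_{W_1}([\mathrm{id}]_{U_1})\),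 and \(W_1\) is the \(\mathrm{Ult}(V,U_1)\)-ultrafilter derived from \(j_{W_1}\) using \(j_{W_0}([\mathrm{id}]_{U_0})\). The Ultrapower Axiom: every pair of countably complete ultrafilters admits a comparison by internal ultrafilters. *)

theory Defs
  imports Main "HOL-Library.FuncSet"
begin

text \<open>
  A type of class \<open>zfc\<close> is a universe of sets \<open>V\<close>, with \<open>elts x\<close> the class of members of \<open>x\<close>.
  Classes are HOL sets over that type. As usual for set theory in HOL, Separation and Replacement
  range over all HOL predicates and functions.
  Choice is a consequence of Replacement and the HOL choice operator; see \<open>zfc_choice\<close>.
\<close>

class zfc =
  fixes elts :: "'a \<Rightarrow> 'a set"
  assumes extensionality: "elts x = elts y \<Longrightarrow> x = y"
    and foundation: "elts x \<noteq> {} \<Longrightarrow> \<exists>y\<in>elts x. elts y \<inter> elts x = {}"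
    and pairing: "\<exists>z. elts z = {x, y}"
    and union: "\<exists>z. elts z = (\<Union>y\<in>elts x. elts y)"
    and powerset: "\<exists>z. elts z = {y. elts y \<subseteq> elts x}"
    and infinity: "\<exists>z. (\<exists>e\<in>elts z. elts e = {}) \<and>
                       (\<forall>y\<in>elts z. \<exists>s\<in>elts z. elts s = insert y (elts y))"
    and separation: "\<exists>z. elts z = {y \<in> elts x. P y}"
    and replacement: "\<exists>z. elts z = F ` elts x"

lemma zfc_choice:
  fixes x :: "'v :: zfc"
  assumes nonempty: "\<And>y. y \<in> elts x \<Longrightarrow> elts y \<noteq> {}"
    and disjoint: "\<And>y z. y \<in> elts x \<Longrightarrow> z \<in> elts x \<Longrightarrow> y \<noteq> z \<Longrightarrow> elts y \<inter> elts z = {}"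
  shows "\<exists>c. \<forall>y\<in>elts x. \<exists>!z. z \<in> elts c \<inter> elts y"
proof -
  define F where "F y = (SOME z. z \<in> elts y)" for y :: 'v
  have F: "F y \<in> elts y" if "y \<in> elts x" for y
    unfolding F_def by (rule someI_ex) (use nonempty[OF that] in blast)
  obtain c where c: "elts c = F ` elts x"
    using replacement by blast
  have "\<exists>!z. z \<in> elts c \<inter> elts y" if y: "y \<in> elts x" for y
  proof (rule ex1I[of _ "F y"])
    show "F y \<in> elts c \<inter> elts y" using F c y by blast
  next
    fix z assume "z \<in> elts c \<inter> elts y"
    then obtain y' where "y' \<in> elts x" "z = F y'" "z \<in> elts y" using c by blast
    then show "z = F y" using F disjoint y by blast
  qed
  then show ?thesis by blast
qed

text \<open>The set with the given members; meaningful only if \<open>X\<close> is not a proper class.\<close>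

definition vset :: "'v::zfc set \<Rightarrow> 'v" where
  "vset X = (THE z. elts z = X)"

definition opair :: "'v::zfc \<Rightarrow> 'v \<Rightarrow> 'v" where
  "opair x y = vset {vset {x}, vset {x, y}}"

definition is_fun_on :: "'v::zfc \<Rightarrow> 'v \<Rightarrow> bool" where
  "is_fun_on f S \<longleftrightarrow>
     (\<forall>p\<in>elts f. \<exists>x\<in>elts S. \<exists>y. p = opair x y) \<and>
     (\<forall>x\<in>elts S. \<exists>!y. opair x y \<in> elts f)"

definition app :: "'v::zfc \<Rightarrow> 'v \<Rightarrow> 'v" where
  "app f x = (THE y. opair x y \<in> elts f)"

definition lam :: "'v::zfc \<Rightarrow> ('v \<Rightarrow> 'v) \<Rightarrow> 'v" where
  "lam S F = vset ((\<lambda>x. opair x (F x)) ` elts S)"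

definition transset :: "'v::zfc \<Rightarrow> bool" where
  "transset x \<longleftrightarrow> (\<forall>y\<in>elts x. elts y \<subseteq> elts x)"

definition ordinal :: "'v::zfc \<Rightarrow> bool" where
  "ordinal x \<longleftrightarrow> transset x \<and> (\<forall>y\<in>elts x. transset y)"

definition omega :: "'v::zfc" where
  "omega = vset {x. ordinal x \<and> finite (elts x)}"

definition nsubsets :: "'v::zfc \<Rightarrow> nat \<Rightarrow> 'v" where
  "nsubsets \<kappa> n = vset {a. elts a \<subseteq> elts \<kappa> \<and> finite (elts a) \<and> card (elts a) = n}"

text \<open>
  The notions below are relative to a class \<open>M\<close>, which in all applications is a transitive model of
  ZFC: either \<open>UNIV\<close> (that is, \<open>V\<close>) or an ultrapower of it. For such \<open>M\<close> the notions \<open>opair\<close>,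
  \<open>is_fun_on\<close>, \<open>app\<close>, \<open>ordinal\<close>, \<open>omega\<close>, \<open>nsubsets\<close> are absolute, so that relativizing only means
  restricting to subsets, sequences and functions that belong to \<open>M\<close>.
\<close>

definition ultrafilter_on :: "'v::zfc set \<Rightarrow> 'v \<Rightarrow> 'v \<Rightarrow> bool" where
  "ultrafilter_on M S U \<longleftrightarrow>
     S \<in> M \<and> U \<in> M \<and>
     (\<forall>X\<in>elts U. elts X \<subseteq> elts S) \<and>
     S \<in> elts U \<and> vset {} \<notin> elts U \<and>
     (\<forall>X\<in>elts U. \<forall>Y\<in>elts U. vset (elts X \<inter> elts Y) \<in> elts U) \<and>
     (\<forall>X\<in>elts U. \<forall>Y\<in>M. elts X \<subseteq> elts Y \<and> elts Y \<subseteq> elts S \<longrightarrow> Y \<in> elts U) \<and>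
     (\<forall>X\<in>M. elts X \<subseteq> elts S \<longrightarrow> X \<in> elts U \<or> vset (elts S - elts X) \<in> elts U)"

definition cc_ultrafilter_on :: "'v::zfc set \<Rightarrow> 'v \<Rightarrow> 'v \<Rightarrow> bool" where
  "cc_ultrafilter_on M S U \<longleftrightarrow>
     ultrafilter_on M S U \<and>
     (\<forall>f\<in>M. is_fun_on f omega \<and> (\<forall>n\<in>elts omega. app f n \<in> elts U) \<longrightarrow>
        vset {x \<in> elts S. \<forall>n\<in>elts omega. x \<in> elts (app f n)} \<in> elts U)"

definition cc_ultrafilter :: "'v::zfc set \<Rightarrow> 'v \<Rightarrow> bool" where
  "cc_ultrafilter M U \<longleftrightarrow> (\<exists>S. cc_ultrafilter_on M S U)"

definition uniform_ultrafilter :: "'v::zfc \<Rightarrow> bool" where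
  "uniform_ultrafilter U \<longleftrightarrow>
     (\<exists>\<kappa> n. ordinal \<kappa> \<and> cc_ultrafilter_on UNIV (nsubsets \<kappa> n) U \<and>
            (\<forall>\<alpha>\<in>elts \<kappa>. nsubsets \<alpha> n \<notin> elts U))"

text \<open>The set on which an ultrafilter lives is recovered as its union.\<close>

definition base :: "'v::zfc \<Rightarrow> 'v" where
  "base U = vset (\<Union>X\<in>elts U. elts X)"

definition ult_funs :: "'v::zfc set \<Rightarrow> 'v \<Rightarrow> 'v set" where
  "ult_funs M U = {f \<in> M. is_fun_on f (base U)}"

definition ult_eq :: "'v::zfc set \<Rightarrow> 'v \<Rightarrow> 'v rel" where
  "ult_eq M U = {(f, g). f \<in> ult_funs M U \<and> g \<in> ult_funs M U \<and>
     vset {x \<in> elts (base U). app f x = app g x} \<in> elts U}"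

definition ult_mem :: "'v::zfc set \<Rightarrow> 'v \<Rightarrow> 'v set rel" where
  "ult_mem M U = {(ult_eq M U `` {f}, ult_eq M U `` {g}) | f g.
     f \<in> ult_funs M U \<and> g \<in> ult_funs M U \<and>
     vset {x \<in> elts (base U). app f x \<in> elts (app g x)} \<in> elts U}"

text \<open>
  The Mostowski collapse of the structure \<open>(A, R)\<close>; it exists uniquely if \<open>R\<close> is well-founded and
  set-like on \<open>A\<close>.
\<close>

definition collapse :: "'b set \<Rightarrow> 'b rel \<Rightarrow> 'b \<Rightarrow> 'v::zfc" where
  "collapse A R = (THE \<pi>. \<pi> \<in> extensional A \<and>
     (\<forall>a\<in>A. elts (\<pi> a) = \<pi> ` {b \<in> A. (b, a) \<in> R}))"

definition ult_class :: "'v::zfc set \<Rightarrow> 'v \<Rightarrow> 'v \<Rightarrow> 'v" where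
  "ult_class M U f =
     collapse (ult_funs M U // ult_eq M U) (ult_mem M U) (ult_eq M U `` {f})"

definition Ult :: "'v::zfc set \<Rightarrow> 'v \<Rightarrow> 'v set" where
  "Ult M U = ult_class M U ` ult_funs M U"

definition ult_emb :: "'v::zfc set \<Rightarrow> 'v \<Rightarrow> 'v \<Rightarrow> 'v" where
  "ult_emb M U x = ult_class M U (lam (base U) (\<lambda>_. x))"

definition ult_id :: "'v::zfc set \<Rightarrow> 'v \<Rightarrow> 'v" where
  "ult_id M U = ult_class M U (lam (base U) (\<lambda>x. x))"

text \<open>\<open>is_derived M j a U\<close>: \<open>U\<close> is the \<open>M\<close>-ultrafilter derived from \<open>j\<close> using \<open>a\<close>.\<close>

definition is_derived :: "'v::zfc set \<Rightarrow> ('v \<Rightarrow> 'v) \<Rightarrow> 'v \<Rightarrow> 'v \<Rightarrow> bool" where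
  "is_derived M j a U \<longleftrightarrow>
     (\<exists>\<delta>\<in>M. ordinal \<delta> \<and> elts a \<subseteq> elts (j \<delta>) \<and>
        (\<forall>\<beta>\<in>M. ordinal \<beta> \<and> elts a \<subseteq> elts (j \<beta>) \<longrightarrow> elts \<delta> \<subseteq> elts \<beta>) \<and>
        elts U = {X \<in> M. elts X \<subseteq> elts (nsubsets \<delta> (card (elts a))) \<and> a \<in> elts (j X)})"

definition comparison :: "'v::zfc \<Rightarrow> 'v \<Rightarrow> 'v \<Rightarrow> 'v \<Rightarrow> bool" where
  "comparison U0 U1 W0 W1 \<longleftrightarrow>
     (let M0 = Ult UNIV U0; M1 = Ult UNIV U1 in
        W0 \<in> M0 \<and> cc_ultrafilter M0 W0 \<and>
        W1 \<in> M1 \<and> cc_ultrafilter M1 W1 \<and>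
        Ult M0 W0 = Ult M1 W1 \<and>
        ult_emb M0 W0 \<circ> ult_emb UNIV U0 = ult_emb M1 W1 \<circ> ult_emb UNIV U1)"

definition canonical_comparison :: "'v::zfc \<Rightarrow> 'v \<Rightarrow> 'v \<Rightarrow> 'v \<Rightarrow> bool" where
  "canonical_comparison U0 U1 W0 W1 \<longleftrightarrow>
     comparison U0 U1 W0 W1 \<and>
     (let M0 = Ult UNIV U0; M1 = Ult UNIV U1 in
        is_derived M0 (ult_emb M0 W0) (ult_emb M1 W1 (ult_id UNIV U1)) W0 \<and>
        is_derived M1 (ult_emb M1 W1) (ult_emb M0 W0 (ult_id UNIV U0)) W1)"

definition ultrapower_axiom :: "'v::zfc itself \<Rightarrow> bool" where
  "ultrapower_axiom _ \<longleftrightarrow>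
     (\<forall>U0 U1 :: 'v. cc_ultrafilter UNIV U0 \<and> cc_ultrafilter UNIV U1 \<longrightarrow>
        (\<exists>W0 W1. comparison U0 U1 W0 W1))"

end

theory Submission
  imports Defs
begin

text \<open>
  Los's theorem is needed only for finitely many concrete notions, and is checked for each of them
  directly, without formulas. The ultrapower itself is one of these notions: the ultraproduct of
  the collapses of the ultrapowers \<open>Ult(C\<^sub>x, W\<^sub>x)\<close> solves the recursion for the collapse of the
  ultrapower of the ultraproduct of the classes \<open>C\<^sub>x\<close>, and such a solution is unique.

  Uniqueness. If two internal ultrapower embeddings of \<open>M\<close> have the same target, they agree on the
  ordinals: the least ordinal at which some such pair disagrees is definable without parameters, so
  both embeddings of a pair send it to the same ordinal. Given two canonical comparisons, compare
  their targets by the Ultrapower Axiom. The composed embeddings of \<open>Ult(V, U\<^sub>0)\<close> agree on the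
  range of \<open>j\<close> and on the finite set of ordinals \<open>[id]\<close>, hence everywhere. Likewise for \<open>U\<^sub>1\<close>, and
  the derived ultrafilters can be read off from the composed embeddings.

  Existence. Replace each ultrafilter of an arbitrary comparison by the one derived from it using the
  image of the seed of the other side. Both new ultrapowers embed into the old target with the same
  range, namely the hull of the range of \<open>j\<close> and the two seeds, so they coincide.
\<close>

section \<open>Sets and ordinals\<close>

text \<open>Proper classes such as \<open>Ult UNIV U\<close> are HOL sets, not elements of the
  universe, so elements, classes and statements of an ultrapower are all represented by families
  over \<open>base U\<close>; a fact about \<open>M = Ult UNIV U\<close> is proved for
  \<open>UNIV\<close> and carried over. The classes in a family must be allowed to vary: the
  ultrapower of \<open>M\<close> by the class of \<open>w\<close> is the ultraproduct of the
  different classes \<open>Ult UNIV (w x)\<close>, and a third ultrapower is taken of those again.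
  The targets of comparisons are ultrapowers of ultrapowers, while the Ultrapower Axiom speaks of
  ultrafilters in the universe. Sums of ultrafilters bridge this: they turn a two-step ultrapower
  into a single one. Done in the universe, this makes the axiom applicable to the targets; done
  inside \<open>M\<close>, it makes a composed embedding of \<open>M\<close> an internal ultrapower
  embedding, to which the agreement on ordinals applies. Uniformity makes the seeds finite sets of
  ordinals. Embeddings act elementwise on finite sets, so agreement on ordinals extends to the
  seeds, whereas it says nothing about infinite sets of ordinals.\<close>

definition small :: "'v::zfc set \<Rightarrow> bool" where
  "small X \<longleftrightarrow> (\<exists>z. elts z = X)"

lemma elts_inject: "elts x = elts y \<longleftrightarrow> x = y"
  using extensionality by blast

lemma elts_vset [simp]: "small X \<Longrightarrow> elts (vset X) = X"
  unfolding small_def vset_def by (rule theI') (metis extensionality)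

lemma vset_elts [simp]: "vset (elts x) = x"
  by (simp add: vset_def elts_inject)

lemma small_elts [simp]: "small (elts x)"
  by (auto simp: small_def)

lemma small_subset: "small Y \<Longrightarrow> X \<subseteq> Y \<Longrightarrow> small X"
proof -
  assume "small Y" "X \<subseteq> Y"
  then obtain y where "elts y = Y" by (auto simp: small_def)
  moreover obtain z where "elts z = {x \<in> elts y. x \<in> X}" using separation[of y "\<lambda>x. x \<in> X"] by auto
  ultimately have "elts z = X" using \<open>X \<subseteq> Y\<close> by blast
  then show ?thesis by (auto simp: small_def)
qed

lemma small_Collect_conj [simp]: "small {x. x \<in> elts z \<and> P x}"
  by (rule small_subset[of "elts z"]) auto

lemma small_image [simp]:
  fixes F :: "'v::zfc \<Rightarrow> 'v"
  assumes "small X" shows "small (F ` X)"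
proof -
  obtain x where x: "elts x = X" using assms by (auto simp: small_def)
  show ?thesis using replacement[of F x] x by (simp add: small_def)
qed

text \<open>Replacement for indices of another type, such as HOL functions, as long as a set of
  codes covers them.\<close>

lemma small_image_code:
  fixes F :: "'a \<Rightarrow> 'v::zfc" and c :: "'v \<Rightarrow> 'a"
  assumes "small Y" and "X \<subseteq> c ` Y" shows "small (F ` X)"
proof -
  have "F ` X \<subseteq> (F \<circ> c) ` Y" using assms(2) by auto
  then show ?thesis by (rule small_subset[OF small_image[OF assms(1)]])
qed

lemma small_empty [simp]: "small {}"
  by (rule small_subset[OF small_elts]) simp

lemma small_UN [simp]:
  fixes B :: "'v::zfc \<Rightarrow> 'v set"
  assumes "small X" "\<And>x. x \<in> X \<Longrightarrow> small (B x)"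
  shows "small (\<Union>x\<in>X. B x)"
proof -
  obtain y where y: "elts y = (\<lambda>x. vset (B x)) ` X"
    using small_image[OF assms(1), of "\<lambda>x. vset (B x)"] by (auto simp: small_def)
  obtain z where "elts z = (\<Union>w\<in>elts y. elts w)" using union[of y] by blast
  then have "elts z = (\<Union>x\<in>X. B x)" using y assms(2) by simp
  then show ?thesis by (auto simp: small_def)
qed

lemma small_pair: "small {x, y}"
  using pairing by (auto simp: small_def)

lemma small_Un [simp]:
  assumes "small X" "small Y" shows "small (X \<union> Y)"
proof -
  have "small (\<Union>z\<in>{vset X, vset Y}. elts z)"
    by (rule small_UN) (auto simp: small_pair)
  then show ?thesis using assms by simp
qed

lemma small_insert [simp]: "small X \<Longrightarrow> small (insert x X)"
  using small_Un[of "{x}" X] small_pair[of x x] by simp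

lemma small_Diff [simp]: "small X \<Longrightarrow> small (X - Y)"
  by (rule small_subset) auto

lemma small_Int [simp]: "small X \<Longrightarrow> small (X \<inter> Y)"
  by (rule small_subset) auto

lemma small_finite: "finite X \<Longrightarrow> small X"
  by (induction rule: finite_induct) auto

lemma small_Pow [simp]:
  assumes "small X" shows "small {y. elts y \<subseteq> X}"
proof -
  obtain x where "elts x = X" using assms by (auto simp: small_def)
  moreover obtain z where "elts z = {y. elts y \<subseteq> elts x}" using powerset[of x] by blast
  ultimately show ?thesis by (auto simp: small_def)
qed

lemma small_Pow_conj [simp]:
  assumes "small X" shows "small {y. elts y \<subseteq> X \<and> P y}"
  by (rule small_subset[OF small_Pow[OF assms]]) auto

lemma singleton_eq_doubleton: "{a} = {b, c} \<longleftrightarrow> a = b \<and> a = c" by auto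

lemma vset_inject: "small X \<Longrightarrow> small Y \<Longrightarrow> vset X = vset Y \<longleftrightarrow> X = Y"
  by (metis elts_vset)

lemma opair_inject [simp]: "opair a b = opair c d \<longleftrightarrow> a = c \<and> b = d"
  by (auto simp: opair_def vset_inject doubleton_eq_iff singleton_eq_doubleton)

lemma mem_lam [simp]: "elts (lam S F) = (\<lambda>x. opair x (F x)) ` elts S"
  by (simp add: lam_def)

lemma is_fun_on_lam [simp]: "is_fun_on (lam S F) S"
  by (auto simp: is_fun_on_def)

lemma app_lam [simp]: "x \<in> elts S \<Longrightarrow> app (lam S F) x = F x"
  by (auto simp: app_def)

lemma app_eqI: "is_fun_on f S \<Longrightarrow> opair x y \<in> elts f \<Longrightarrow> app f x = y"
  unfolding app_def is_fun_on_def by (rule the1_equality) (metis opair_inject)+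

lemma app_mem: "is_fun_on f S \<Longrightarrow> x \<in> elts S \<Longrightarrow> opair x (app f x) \<in> elts f"
  unfolding app_def is_fun_on_def by (rule theI') auto

lemma not_mem_self: "x \<notin> elts x"
proof
  assume "x \<in> elts x"
  moreover have "elts (vset {x}) \<noteq> {}" by simp
  ultimately show False using foundation[of "vset {x}"] by auto
qed

fun vnat :: "nat \<Rightarrow> 'v::zfc" where
  "vnat 0 = vset {}"
| "vnat (Suc n) = vset (insert (vnat n) (elts (vnat n)))"

lemma elts_vnat: "elts (vnat n) = vnat ` {..<n}"
  by (induction n) (simp_all add: lessThan_Suc small_finite)

lemma vnat_inj: "inj (vnat :: nat \<Rightarrow> 'v::zfc)"
proof -
  have "vnat m \<noteq> (vnat n :: 'v)" if "m < n" for m n :: nat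
  proof -
    have "vnat m \<in> elts (vnat n :: 'v)" using that by (simp add: elts_vnat)
    then show ?thesis using not_mem_self by metis
  qed
  then show ?thesis by (metis injI linorder_neqE_nat)
qed

lemma small_range_nat: "small (range (f :: nat \<Rightarrow> 'v::zfc))"
proof -
  obtain z :: 'v where e: "\<exists>e\<in>elts z. elts e = {}"
    and s: "\<forall>y\<in>elts z. \<exists>s\<in>elts z. elts s = insert y (elts y)"
    using infinity by blast
  have "vnat n \<in> elts z" for n
  proof (induction n)
    case 0
    then show ?case using e by (metis vnat.simps(1) vset_elts)
  next
    case (Suc n)
    then show ?case using s by (metis vnat.simps(2) vset_elts)
  qed
  then have "small (range (vnat :: nat \<Rightarrow> 'v))"
    by (intro small_subset[OF small_elts[of z]]) auto
  then have "small ((\<lambda>x. f (inv vnat x)) ` range (vnat :: nat \<Rightarrow> 'v))" by (rule small_image)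
  moreover have "(\<lambda>x. f (inv vnat x)) ` range (vnat :: nat \<Rightarrow> 'v) = range f"
    by (auto simp: image_image inv_f_f[OF vnat_inj])
  ultimately show ?thesis by simp
qed

text \<open>The axiom of foundation concerns sets only, so the class \<open>Q\<close> is cut down to
  its part inside the transitive closure \<open>C\<close> of one of its elements. \<open>T n\<close>
  is the \<open>n\<close>-fold union of \<open>x\<close>.\<close>

lemma wf_mem: "wf {(x, y :: 'v::zfc). x \<in> elts y}"
proof (rule wfI_min)
  fix x :: 'v and Q assume x: "x \<in> Q"
  define T where "T = rec_nat x (\<lambda>_ y. vset (\<Union>z\<in>elts y. elts z))"
  define C where "C = vset (insert x (\<Union>y\<in>range T. elts y))"
  have C: "elts C = insert x (\<Union>y\<in>range T. elts y)"
    unfolding C_def by (intro elts_vset small_insert small_UN small_range_nat small_elts)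
  have T0: "T 0 = x" and TS: "elts (T (Suc n)) = (\<Union>z\<in>elts (T n). elts z)" for n
    by (simp_all add: T_def)
  have trans: "z \<in> elts C" if "y \<in> elts C" "z \<in> elts y" for y z
  proof -
    from that(1) C consider "y = x" | n where "y \<in> elts (T n)" by auto
    then show ?thesis
    proof cases
      case 1
      then have "z \<in> elts (T 0)" using that T0 by simp
      then show ?thesis using C by blast
    next
      case 2
      then have "z \<in> elts (T (Suc n))" using that TS by blast
      then show ?thesis using C by blast
    qed
  qed
  have "elts (vset {y. y \<in> elts C \<and> y \<in> Q}) \<noteq> {}"
    using x C small_Collect_conj[of C "\<lambda>y. y \<in> Q"] by (auto simp del: small_Collect_conj)
  from foundation[OF this] obtain y where "y \<in> elts C" "y \<in> Q"
    "\<forall>z\<in>elts y. \<not> (z \<in> elts C \<and> z \<in> Q)"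
    using small_Collect_conj[of C "\<lambda>y. y \<in> Q"] by auto
  then show "\<exists>z\<in>Q. \<forall>y. (y, z) \<in> {(x, y). x \<in> elts y} \<longrightarrow> y \<notin> Q"
    using trans by blast
qed

lemma elts_induct: "(\<And>x. (\<And>y. y \<in> elts x \<Longrightarrow> P y) \<Longrightarrow> P x) \<Longrightarrow> P (x::'v::zfc)"
  using wf_induct_rule[OF wf_mem, of P x] by blast

lemma ordinal_mem: "ordinal \<alpha> \<Longrightarrow> \<beta> \<in> elts \<alpha> \<Longrightarrow> ordinal \<beta>"
  unfolding ordinal_def transset_def by blast

lemma ordinal_linear:
  "ordinal \<alpha> \<Longrightarrow> ordinal \<beta> \<Longrightarrow> \<alpha> \<in> elts \<beta> \<or> \<alpha> = \<beta> \<or> \<beta> \<in> elts \<alpha>"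
proof (induction \<alpha> arbitrary: \<beta> rule: elts_induct)
  case (1 \<alpha>)
  note IH1 = 1
  show ?case using \<open>ordinal \<beta>\<close>
  proof (induction \<beta> rule: elts_induct)
    case (1 \<beta>)
    show ?case
    proof (rule ccontr)
      assume n: "\<not> ?thesis"
      have "\<gamma> \<in> elts \<beta>" if "\<gamma> \<in> elts \<alpha>" for \<gamma>
        using IH1(1)[OF that ordinal_mem[OF IH1(2) that] 1(2)] n that IH1(2)
        by (auto simp: ordinal_def transset_def)
      moreover have "\<gamma> \<in> elts \<alpha>" if "\<gamma> \<in> elts \<beta>" for \<gamma>
        using 1(1)[OF that ordinal_mem[OF 1(2) that]] n that 1(2)
        by (auto simp: ordinal_def transset_def)
      ultimately have "\<alpha> = \<beta>" by (intro extensionality) auto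
      then show False using n by simp
    qed
  qed
qed

lemma ordinal_not_mem_subset:
  "ordinal \<alpha> \<Longrightarrow> ordinal \<beta> \<Longrightarrow> \<beta> \<notin> elts \<alpha> \<Longrightarrow> elts \<alpha> \<subseteq> elts \<beta>"
  using ordinal_linear[of \<alpha> \<beta>] by (auto simp: ordinal_def transset_def)

lemma ordinal_vnat: "ordinal (vnat n)"
  by (auto simp: ordinal_def transset_def elts_vnat)

lemma finite_ordinal_vnat:
  "ordinal x \<Longrightarrow> finite (elts x) \<Longrightarrow> x \<in> range vnat"
proof (induction x rule: elts_induct)
  case (1 x)
  define K where "K = {n. vnat n \<in> elts x}"
  have "y \<in> range vnat" if "y \<in> elts x" for y
    using 1(1)[OF that ordinal_mem[OF 1(2) that]] 1(2,3) that
    by (auto simp: ordinal_def transset_def intro: finite_subset)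
  then have x: "elts x = vnat ` K" by (auto simp: K_def)
  have fin: "finite K"
    using 1(3) x vnat_inj by (metis finite_imageD inj_on_subset subset_UNIV)
  have down: "m \<in> K" if "n \<in> K" "m < n" for m n
  proof -
    have "vnat m \<in> elts (vnat n :: 'a)" using that by (simp add: elts_vnat)
    then show ?thesis using that 1(2) by (auto simp: K_def ordinal_def transset_def)
  qed
  define N where "N = (LEAST n. n \<notin> K)"
  have N: "N \<notin> K" unfolding N_def by (rule LeastI_ex) (use fin ex_new_if_finite in auto)
  have "n \<in> K" if "n < N" for n using that not_less_Least unfolding N_def by blast
  moreover have "n < N" if "n \<in> K" for n
    using down[OF that, of N] N that by (metis linorder_neqE_nat)
  ultimately have "K = {..<N}" by auto
  then have "x = vnat N" using x by (intro extensionality) (simp add: elts_vnat)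
  then show ?case by simp
qed

lemma elts_omega: "elts (omega :: 'v::zfc) = range vnat"
proof -
  have "{x :: 'v. ordinal x \<and> finite (elts x)} = range vnat"
    using finite_ordinal_vnat ordinal_vnat by (auto simp: elts_vnat)
  then show ?thesis using small_range_nat[of "vnat :: nat \<Rightarrow> 'v"] by (simp add: omega_def)
qed

lemma elts_nsubsets [simp]:
  "elts (nsubsets \<kappa> n) = {a. elts a \<subseteq> elts \<kappa> \<and> finite (elts a) \<and> card (elts a) = n}"
  by (simp add: nsubsets_def)

text \<open>Any solution of the collapse recursion is the collapse: well-foundedness of the relation
  is inherited from membership between the values of the solution.\<close>

lemma collapse_eq:
  fixes \<pi> :: "'b \<Rightarrow> 'v::zfc"
  assumes \<pi>: "\<And>a. a \<in> A \<Longrightarrow> elts (\<pi> a) = \<pi> ` {b \<in> A. (b, a) \<in> R}" and a: "a \<in> A"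
  shows "collapse A R a = \<pi> a"
proof -
  let ?P = "\<lambda>\<rho> :: 'b \<Rightarrow> 'v. \<rho> \<in> extensional A \<and> (\<forall>a\<in>A. elts (\<rho> a) = \<rho> ` {b \<in> A. (b, a) \<in> R})"
  have "collapse A R = restrict \<pi> A"
    unfolding collapse_def
  proof (rule the_equality)
    show "?P (restrict \<pi> A)"
    proof (intro conjI ballI)
      fix a assume "a \<in> A"
      moreover have "restrict \<pi> A ` {b \<in> A. (b, a) \<in> R} = \<pi> ` {b \<in> A. (b, a) \<in> R}"
        by (rule image_cong) auto
      ultimately show "elts (restrict \<pi> A a) = restrict \<pi> A ` {b \<in> A. (b, a) \<in> R}"
        using \<pi> by simp
    qed simp
  next
    fix \<rho> assume \<rho>: "?P \<rho>"
    have "a \<in> A \<Longrightarrow> x = \<pi> a \<Longrightarrow> \<rho> a = \<pi> a" for a x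
    proof (induction x arbitrary: a rule: elts_induct)
      case (1 x)
      have "\<rho> b = \<pi> b" if "b \<in> A" "(b, a) \<in> R" for b
        using 1 that \<pi> by blast
      then have "\<rho> ` {b \<in> A. (b, a) \<in> R} = \<pi> ` {b \<in> A. (b, a) \<in> R}" by (intro image_cong) auto
      then show ?case using \<rho> \<pi> 1(2) by (intro extensionality) simp
    qed
    then show "\<rho> = restrict \<pi> A" using \<rho> by (intro ext) (auto simp: extensional_def)
  qed
  then show ?thesis using a by simp
qed

text \<open>A solution of the recursion given on representing functions descends to the quotient by
  congruence, and there \<open>collapse_eq\<close> identifies it with the collapse.\<close>

lemma ult_class_eq:
  fixes \<pi> :: "'v::zfc \<Rightarrow> 'v"
  assumes W: "base W \<in> elts W"
    and cong: "\<And>f g. (f, g) \<in> ult_eq M W \<Longrightarrow> \<pi> f = \<pi> g"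
    and rec: "\<And>f. f \<in> ult_funs M W \<Longrightarrow> elts (\<pi> f) =
      \<pi> ` {g \<in> ult_funs M W. vset {x \<in> elts (base W). app g x \<in> elts (app f x)} \<in> elts W}"
    and f: "f \<in> ult_funs M W"
  shows "ult_class M W f = \<pi> f"
proof -
  let ?E = "ult_eq M W"
  have refl: "g \<in> ?E `` {g}" if "g \<in> ult_funs M W" for g
    using that W by (simp add: ult_eq_def)
  have eqD: "\<pi> g = \<pi> h" if "?E `` {g} = ?E `` {h}" "h \<in> ult_funs M W" for g h
    using refl[OF that(2)] that(1) cong[of g h] by blast
  define \<rho> where "\<rho> c = \<pi> (SOME g. g \<in> ult_funs M W \<and> c = ?E `` {g})" for c
  have \<rho>: "\<rho> (?E `` {g}) = \<pi> g" if g: "g \<in> ult_funs M W" for g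
  proof -
    define h where "h = (SOME h. h \<in> ult_funs M W \<and> ?E `` {g} = ?E `` {h})"
    have "h \<in> ult_funs M W \<and> ?E `` {g} = ?E `` {h}"
      unfolding h_def by (rule someI[of _ g]) (use g in simp)
    then show ?thesis using eqD[of g h] by (simp add: \<rho>_def h_def)
  qed
  have "collapse (ult_funs M W // ?E) (ult_mem M W) (?E `` {f}) = \<rho> (?E `` {f})"
  proof (rule collapse_eq)
    show "?E `` {f} \<in> ult_funs M W // ?E" using f by (rule quotientI)
  next
    fix a assume "a \<in> ult_funs M W // ?E"
    then obtain g where g: "g \<in> ult_funs M W" and a: "a = ?E `` {g}" by (rule quotientE)
    show "elts (\<rho> a) = \<rho> ` {b \<in> ult_funs M W // ?E. (b, a) \<in> ult_mem M W}"
    proof (intro equalityI subsetI)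
      fix y assume "y \<in> elts (\<rho> a)"
      then obtain h where h: "h \<in> ult_funs M W" "y = \<pi> h"
        "vset {x \<in> elts (base W). app h x \<in> elts (app g x)} \<in> elts W"
        using \<rho>[OF g] rec[OF g] a by auto
      have "(?E `` {h}, a) \<in> ult_mem M W" using h g a by (auto simp: ult_mem_def)
      moreover have "?E `` {h} \<in> ult_funs M W // ?E" using h by (blast intro: quotientI)
      ultimately show "y \<in> \<rho> ` {b \<in> ult_funs M W // ?E. (b, a) \<in> ult_mem M W}"
        using \<rho>[OF h(1)] h(2) by force
    next
      fix y assume "y \<in> \<rho> ` {b \<in> ult_funs M W // ?E. (b, a) \<in> ult_mem M W}"
      then obtain h g' where h: "h \<in> ult_funs M W" "y = \<rho> (?E `` {h})"
        and g': "g' \<in> ult_funs M W" "a = ?E `` {g'}"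
        and m: "vset {x \<in> elts (base W). app h x \<in> elts (app g' x)} \<in> elts W"
        by (auto simp: ult_mem_def)
      have "\<pi> h \<in> elts (\<pi> g')" using rec[OF g'(1)] m h by blast
      then show "y \<in> elts (\<rho> a)" using h g' \<rho> by simp
    qed
  qed
  then show ?thesis using \<rho> f by (simp add: ult_class_def)
qed

section \<open>Ultrapowers of the universe\<close>

definition ae :: "'v::zfc \<Rightarrow> ('v \<Rightarrow> bool) \<Rightarrow> bool" where
  "ae U P \<longleftrightarrow> vset {x \<in> elts (base U). P x} \<in> elts U"

text \<open>Any HOL function may serve as a representative: by Replacement its restriction to
  \<open>base U\<close> is a set. This spares all coding of functions as sets of pairs in later
  arguments.\<close>

definition cls :: "'v::zfc \<Rightarrow> ('v \<Rightarrow> 'v) \<Rightarrow> 'v" where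
  "cls U F = ult_class UNIV U (lam (base U) F)"

lemma ultrafilter_onD:
  assumes "ultrafilter_on M S U"
  shows "S \<in> M" "U \<in> M" "\<And>X. X\<in>elts U \<Longrightarrow> elts X \<subseteq> elts S" "S \<in> elts U" "vset {} \<notin> elts U"
     "\<And>X Y. X\<in>elts U \<Longrightarrow> Y\<in>elts U \<Longrightarrow> vset (elts X \<inter> elts Y) \<in> elts U"
     "\<And>X Y. X\<in>elts U \<Longrightarrow> Y\<in>M \<Longrightarrow> elts X \<subseteq> elts Y \<Longrightarrow> elts Y \<subseteq> elts S \<Longrightarrow> Y \<in> elts U"
     "\<And>X. X\<in>M \<Longrightarrow> elts X \<subseteq> elts S \<Longrightarrow> X \<in> elts U \<or> vset (elts S - elts X) \<in> elts U"
  using assms unfolding ultrafilter_on_def by blast+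

lemma base_eq: "ultrafilter_on M S U \<Longrightarrow> base U = S"
proof -
  assume U: "ultrafilter_on M S U"
  then have "(\<Union>X\<in>elts U. elts X) = elts S" by (auto simp: ultrafilter_on_def)
  then show ?thesis by (simp add: base_def)
qed

lemma cc_ultrafilter_base: "cc_ultrafilter M U \<Longrightarrow> cc_ultrafilter_on M (base U) U"
  using base_eq by (auto simp: cc_ultrafilter_def cc_ultrafilter_on_def)

lemma lam_base_funs [simp]: "lam (base U) F \<in> ult_funs UNIV U"
  by (simp add: ult_funs_def)

context
  fixes U :: "'v::zfc"
  assumes U: "cc_ultrafilter UNIV U"
begin

lemma uf_on_base: "ultrafilter_on UNIV (base U) U"
  using cc_ultrafilter_base[OF U] by (simp add: cc_ultrafilter_on_def)

lemmas uf_D = ultrafilter_onD[OF uf_on_base]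

lemmas base_mem_uf = uf_D(4) and empty_notin_uf = uf_D(5)

lemma mem_uf_iff_ae: "X \<in> elts U \<longleftrightarrow> elts X \<subseteq> elts (base U) \<and> ae U (\<lambda>x. x \<in> elts X)"
proof -
  have "vset {x \<in> elts (base U). x \<in> elts X} = X" if "elts X \<subseteq> elts (base U)"
  proof -
    have "{x \<in> elts (base U). x \<in> elts X} = elts X" using that by blast
    then show ?thesis by simp
  qed
  then show ?thesis using uf_D(3) by (auto simp: ae_def)
qed

lemma ae_mono:
  assumes "ae U P" "\<And>x. x \<in> elts (base U) \<Longrightarrow> P x \<Longrightarrow> Q x" shows "ae U Q"
proof -
  have "vset {x \<in> elts (base U). Q x} \<in> elts U"
    if "elts (vset {x \<in> elts (base U). P x}) \<subseteq> elts (vset {x \<in> elts (base U). Q x})"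
      "elts (vset {x \<in> elts (base U). Q x}) \<subseteq> elts (base U)"
    using assms(1) that uf_D(7) unfolding ae_def by blast
  then show ?thesis using assms(2) unfolding ae_def by (simp add: Collect_mono subset_iff)
qed

lemma ae_base: "ae U (\<lambda>x. x \<in> elts (base U))"
  using base_mem_uf by (simp add: mem_uf_iff_ae)

lemma ae_const [simp]: "ae U (\<lambda>_. P) \<longleftrightarrow> P"
proof (cases P)
  case True
  then show ?thesis using ae_mono[OF ae_base] by simp
next
  case False
  then show ?thesis using empty_notin_uf by (simp add: ae_def)
qed

lemma ae_conj: "ae U (\<lambda>x. P x \<and> Q x) \<longleftrightarrow> ae U P \<and> ae U Q"
proof
  assume "ae U P \<and> ae U Q"
  then have "vset (elts (vset {x \<in> elts (base U). P x}) \<inter> elts (vset {x \<in> elts (base U). Q x}))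
      \<in> elts U"
    using uf_D(6) unfolding ae_def by blast
  moreover have "{x \<in> elts (base U). P x} \<inter> {x \<in> elts (base U). Q x} =
      {x \<in> elts (base U). P x \<and> Q x}" by blast
  ultimately show "ae U (\<lambda>x. P x \<and> Q x)" by (simp add: ae_def)
qed (auto elim: ae_mono)

lemma ae_not: "ae U (\<lambda>x. \<not> P x) \<longleftrightarrow> \<not> ae U P"
proof
  assume "ae U (\<lambda>x. \<not> P x)"
  then have "\<not> ae U P" using ae_conj[of P "\<lambda>x. \<not> P x"] by simp
  then show "\<not> ae U P" .
next
  assume n: "\<not> ae U P"
  have "vset {x \<in> elts (base U). P x} \<in> elts U \<or>
      vset (elts (base U) - elts (vset {x \<in> elts (base U). P x})) \<in> elts U"
    by (rule uf_D(8)) auto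
  moreover have "elts (base U) - {x \<in> elts (base U). P x} = {x \<in> elts (base U). \<not> P x}" by blast
  ultimately show "ae U (\<lambda>x. \<not> P x)" using n by (simp add: ae_def)
qed

lemma ae_disj: "ae U (\<lambda>x. P x \<or> Q x) \<longleftrightarrow> ae U P \<or> ae U Q"
  using ae_not[of "\<lambda>x. P x \<or> Q x"] ae_conj[of "\<lambda>x. \<not> P x" "\<lambda>x. \<not> Q x"] ae_not[of P] ae_not[of Q]
  by auto

lemma ae_imp: "ae U (\<lambda>x. P x \<longrightarrow> Q x) \<longleftrightarrow> (ae U P \<longrightarrow> ae U Q)"
  using ae_disj[of "\<lambda>x. \<not> P x" Q] ae_not[of P] unfolding imp_conv_disj by blast

lemma ae_iff: "ae U (\<lambda>x. P x \<longleftrightarrow> Q x) \<longleftrightarrow> (ae U P \<longleftrightarrow> ae U Q)"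
  using ae_conj[of "\<lambda>x. P x \<longrightarrow> Q x" "\<lambda>x. Q x \<longrightarrow> P x"] ae_imp[of P Q] ae_imp[of Q P]
  unfolding iff_conv_conj_imp by blast

text \<open>The existential step of Los's theorem, with HOL choice supplying the witnesses. The type
  of \<open>y\<close> is arbitrary; later the witnesses are sometimes whole functions on the
  universe.\<close>

lemma ae_ex: "ae U (\<lambda>x. \<exists>y. P x y) \<longleftrightarrow> (\<exists>F. ae U (\<lambda>x. P x (F x)))"
proof
  assume "ae U (\<lambda>x. \<exists>y. P x y)"
  then have "ae U (\<lambda>x. P x (SOME y. P x y))" by (rule ae_mono) (auto intro: someI)
  then show "\<exists>F. ae U (\<lambda>x. P x (F x))" by (rule exI[of _ "\<lambda>x. SOME y. P x y"])
qed (auto elim: ae_mono)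

lemma ae_all: "ae U (\<lambda>x. \<forall>y. P x y) \<longleftrightarrow> (\<forall>F. ae U (\<lambda>x. P x (F x)))"
  using ae_ex[of "\<lambda>x y. \<not> P x y"] ae_not[of "\<lambda>x. \<forall>y. P x y"] ae_not by auto

lemma ae_omega:
  fixes P :: "'v \<Rightarrow> 'v \<Rightarrow> bool"
  assumes "\<And>m. m \<in> elts omega \<Longrightarrow> ae U (P m)"
  shows "ae U (\<lambda>x. \<forall>m\<in>elts omega. P m x)"
proof -
  let ?f = "lam omega (\<lambda>m. vset {x \<in> elts (base U). P m x})"
  have "\<forall>f. is_fun_on f omega \<and> (\<forall>n\<in>elts omega. app f n \<in> elts U) \<longrightarrow>
      vset {x \<in> elts (base U). \<forall>n\<in>elts omega. x \<in> elts (app f n)} \<in> elts U"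
    using cc_ultrafilter_base[OF U] by (simp add: cc_ultrafilter_on_def)
  from this[rule_format, of ?f]
  have "vset {x \<in> elts (base U). \<forall>n\<in>elts omega. x \<in> elts (app ?f n)} \<in> elts U"
    using assms by (simp add: ae_def)
  moreover have "{x \<in> elts (base U). \<forall>n\<in>elts omega. x \<in> elts (app ?f n)} =
      {x \<in> elts (base U). \<forall>n\<in>elts omega. P n x}"
    by auto
  ultimately show ?thesis by (simp add: ae_def)
qed

lemma ae_nat: "ae U (\<lambda>x. \<forall>n::nat. P n x) \<longleftrightarrow> (\<forall>n. ae U (P n))"
proof
  assume "\<forall>n. ae U (P n)"
  then have "ae U (\<lambda>x. \<forall>m\<in>elts omega. P (inv (vnat :: nat \<Rightarrow> 'v) m) x)"
    by (intro ae_omega) (auto simp: elts_omega inv_f_f[OF vnat_inj])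
  then show "ae U (\<lambda>x. \<forall>n. P n x)"
    by (rule ae_mono) (simp add: elts_omega inv_f_f[OF vnat_inj])
qed (auto elim: ae_mono)

text \<open>By countable completeness, the countably many steps of a descending chain hold
  simultaneously at almost every point, which would give a descending membership chain
  there.\<close>

lemma wf_ae_mem: "wf {(G, F :: 'v \<Rightarrow> 'v). ae U (\<lambda>x. G x \<in> elts (F x))}"
  unfolding wf_iff_no_infinite_down_chain
proof
  assume "\<exists>f. \<forall>i. (f (Suc i), f i) \<in> {(G, F :: 'v \<Rightarrow> 'v). ae U (\<lambda>x. G x \<in> elts (F x))}"
  then obtain f :: "nat \<Rightarrow> 'v \<Rightarrow> 'v"
    where "\<forall>i. ae U (\<lambda>x. f (Suc i) x \<in> elts (f i x))" by auto
  then have "ae U (\<lambda>x. \<forall>i. f (Suc i) x \<in> elts (f i x))" by (simp add: ae_nat)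
  then have "ae U (\<lambda>x. False)"
  proof (rule ae_mono)
    fix x assume "\<forall>i. f (Suc i) x \<in> elts (f i x)"
    then show False
      using wf_mem[unfolded wf_iff_no_infinite_down_chain, THEN notE, OF exI[of _ "\<lambda>i. f i x"]]
      by simp
  qed
  then show False by simp
qed

text \<open>Every function that is almost everywhere in \<open>F\<close> agrees almost everywhere with one in
  \<open>ult_below F\<close>, and \<open>ult_below F\<close> is of set size.\<close>

definition ult_below :: "('v \<Rightarrow> 'v) \<Rightarrow> ('v \<Rightarrow> 'v) set" where
  "ult_below F = {G. (\<forall>x\<in>elts (base U). G x \<in> insert (vset {}) (elts (F x))) \<and>
     (\<forall>x. x \<notin> elts (base U) \<longrightarrow> G x = vset {}) \<and> ae U (\<lambda>x. G x \<in> elts (F x))}"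

lemma small_ult_below:
  fixes \<pi> :: "('v \<Rightarrow> 'v) \<Rightarrow> 'v"
  shows "small (\<pi> ` ult_below F)"
proof -
  \<comment> \<open>The graph on \<open>base U\<close> of a function in \<open>ult_below F\<close>
    is a subset of \<open>Q\<close>. Since such functions take the default value
    \<open>vset {}\<close> off \<open>base U\<close>, the graph determines them, and
    \<open>dec\<close> recovers them.\<close>
  define Q where "Q = (\<Union>x\<in>elts (base U). (\<Union>y\<in>insert (vset {}) (elts (F x)). {opair x y}))"
  have Q: "small Q" unfolding Q_def by (intro small_UN) (auto intro: small_finite)
  define dec where "dec f x = (if x \<in> elts (base U) then app f x else vset {})" for f x :: 'v
  have "ult_below F \<subseteq> dec ` {f. elts f \<subseteq> Q}"
  proof
    fix G assume G: "G \<in> ult_below F"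
    have "dec (lam (base U) G) = G" using G by (auto simp: dec_def ult_below_def)
    moreover have "elts (lam (base U) G) \<subseteq> Q" using G by (fastforce simp: Q_def ult_below_def)
    ultimately show "G \<in> dec ` {f. elts f \<subseteq> Q}"
      by (intro image_eqI[of _ _ "lam (base U) G"]) auto
  qed
  then show ?thesis by (rule small_image_code[OF small_Pow[OF Q]])
qed

text \<open>The collapse, defined by recursion directly on functions instead of their equivalence
  classes. Recursing over \<open>ult_below F\<close> keeps the argument of \<open>vset\<close>
  small; \<open>elts_ult_val\<close> then recovers the full recursion.\<close>

definition ult_val :: "('v \<Rightarrow> 'v) \<Rightarrow> 'v" where
  "ult_val = wfrec {(G, F). ae U (\<lambda>x. G x \<in> elts (F x))} (\<lambda>\<pi> F. vset (\<pi> ` ult_below F))"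

lemma elts_ult_val_below: "elts (ult_val F) = ult_val ` ult_below F"
proof -
  let ?R = "{(G, F). ae U (\<lambda>x. G x \<in> elts (F x))}"
  have "ult_val F = vset (cut ult_val ?R F ` ult_below F)"
    unfolding ult_val_def by (subst wfrec[OF wf_ae_mem]) simp
  also have "cut ult_val ?R F ` ult_below F = ult_val ` ult_below F"
    by (rule image_cong) (auto simp: ult_below_def cut_def)
  finally show ?thesis by (simp add: small_ult_below)
qed

lemma ult_below_ex:
  assumes "ae U (\<lambda>x. G x \<in> elts (F x))"
  shows "\<exists>G'\<in>ult_below F. ae U (\<lambda>x. G' x = G x)"
proof -
  let ?G = "\<lambda>x. if x \<in> elts (base U) \<and> G x \<in> elts (F x) then G x else vset {}"
  have "ae U (\<lambda>x. ?G x = G x)" using assms by (rule ae_mono) simp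
  moreover have "ae U (\<lambda>x. ?G x \<in> elts (F x))" using assms by (rule ae_mono) simp
  then have "?G \<in> ult_below F" by (auto simp: ult_below_def)
  ultimately show ?thesis by (intro bexI[of _ ?G])
qed

lemma ult_val_cong: "ae U (\<lambda>x. F x = F' x) \<Longrightarrow> ult_val F = ult_val F'"
proof (induction F arbitrary: F' rule: wf_induct_rule[OF wf_ae_mem])
  case (1 F)
  have *: "ult_val G \<in> elts (ult_val F')" if "G \<in> ult_below F" for G
  proof -
    have G: "ae U (\<lambda>x. G x \<in> elts (F x))" using that by (simp add: ult_below_def)
    then have "ae U (\<lambda>x. G x \<in> elts (F x) \<and> F x = F' x)" using 1(2) by (simp add: ae_conj)
    then have "ae U (\<lambda>x. G x \<in> elts (F' x))" by (rule ae_mono) auto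
    then obtain G' where G': "G' \<in> ult_below F'" "ae U (\<lambda>x. G' x = G x)"
      using ult_below_ex by blast
    then have "ae U (\<lambda>x. G x = G' x)" by (auto elim: ae_mono)
    then have "ult_val G = ult_val G'" using 1(1) G by simp
    then show ?thesis using G'(1) elts_ult_val_below by simp
  qed
  have **: "ult_val G \<in> elts (ult_val F)" if "G \<in> ult_below F'" for G
  proof -
    have "ae U (\<lambda>x. G x \<in> elts (F' x) \<and> F x = F' x)"
      using that 1(2) by (simp add: ae_conj ult_below_def)
    then have "ae U (\<lambda>x. G x \<in> elts (F x))" by (rule ae_mono) auto
    then obtain G' where G': "G' \<in> ult_below F" "ae U (\<lambda>x. G' x = G x)"
      using ult_below_ex by blast
    then have "ult_val G' = ult_val G" using 1(1) by (simp add: ult_below_def)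
    then show ?thesis using G'(1) elts_ult_val_below by (metis imageI)
  qed
  show ?case
  proof (rule extensionality, intro equalityI subsetI)
    fix y assume "y \<in> elts (ult_val F)"
    then show "y \<in> elts (ult_val F')" using * by (auto simp: elts_ult_val_below)
  next
    fix y assume "y \<in> elts (ult_val F')"
    then obtain G where "G \<in> ult_below F'" "y = ult_val G" by (auto simp: elts_ult_val_below)
    then show "y \<in> elts (ult_val F)" using ** by blast
  qed
qed

lemma elts_ult_val: "elts (ult_val F) = ult_val ` {G. ae U (\<lambda>x. G x \<in> elts (F x))}"
proof (intro equalityI subsetI)
  fix y assume "y \<in> elts (ult_val F)"
  then show "y \<in> ult_val ` {G. ae U (\<lambda>x. G x \<in> elts (F x))}"
    by (auto simp: elts_ult_val_below ult_below_def)
next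
  fix y assume "y \<in> ult_val ` {G. ae U (\<lambda>x. G x \<in> elts (F x))}"
  then obtain G where "y = ult_val G" "ae U (\<lambda>x. G x \<in> elts (F x))" by blast
  moreover then obtain G' where "G' \<in> ult_below F" "ae U (\<lambda>x. G' x = G x)"
    using ult_below_ex by blast
  ultimately show "y \<in> elts (ult_val F)"
    using ult_val_cong elts_ult_val_below by (metis imageI)
qed

lemma ult_class_UNIV: "f \<in> ult_funs UNIV U \<Longrightarrow> ult_class UNIV U f = ult_val (app f)"
proof (rule ult_class_eq)
  show "base U \<in> elts U" by (rule base_mem_uf)
next
  fix f g assume "(f, g) \<in> ult_eq UNIV U"
  then show "ult_val (app f) = ult_val (app g)"
    by (intro ult_val_cong) (simp add: ult_eq_def ae_def)
next
  fix f assume f: "f \<in> ult_funs UNIV U"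
  show "elts (ult_val (app f)) = (\<lambda>f. ult_val (app f)) ` {g \<in> ult_funs UNIV U.
      vset {x \<in> elts (base U). app g x \<in> elts (app f x)} \<in> elts U}"
  proof (intro equalityI subsetI)
    fix y assume "y \<in> elts (ult_val (app f))"
    then obtain G where G: "y = ult_val G" "ae U (\<lambda>x. G x \<in> elts (app f x))"
      by (auto simp: elts_ult_val)
    let ?g = "lam (base U) G"
    have eq: "ae U (\<lambda>x. app ?g x = G x)" using ae_base by (rule ae_mono) simp
    then have "ae U (\<lambda>x. app ?g x \<in> elts (app f x))"
      using G(2) ae_conj[of "\<lambda>x. app ?g x = G x" "\<lambda>x. G x \<in> elts (app f x)"]
      by (auto elim: ae_mono)
    moreover have "ult_val (app ?g) = y" using G ult_val_cong[OF eq] by simp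
    ultimately show "y \<in> (\<lambda>f. ult_val (app f)) ` {g \<in> ult_funs UNIV U.
      vset {x \<in> elts (base U). app g x \<in> elts (app f x)} \<in> elts U}"
      by (intro image_eqI[of _ _ ?g]) (auto simp: ae_def)
  next
    fix y assume "y \<in> (\<lambda>f. ult_val (app f)) ` {g \<in> ult_funs UNIV U.
      vset {x \<in> elts (base U). app g x \<in> elts (app f x)} \<in> elts U}"
    then show "y \<in> elts (ult_val (app f))" by (auto simp: elts_ult_val ae_def)
  qed
qed

lemma cls_eq_ult_val: "cls U F = ult_val F"
proof -
  have "ae U (\<lambda>x. app (lam (base U) F) x = F x)" using ae_base by (rule ae_mono) simp
  then show ?thesis by (simp add: cls_def ult_class_UNIV ult_val_cong)
qed

lemma ult_class_UNIV_cls: "f \<in> ult_funs UNIV U \<Longrightarrow> ult_class UNIV U f = cls U (app f)"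
  by (simp add: ult_class_UNIV cls_eq_ult_val)

lemma elts_cls: "elts (cls U F) = cls U ` {G. ae U (\<lambda>x. G x \<in> elts (F x))}"
  by (simp add: cls_eq_ult_val elts_ult_val)

text \<open>Injectivity of the collapse, by induction on the common value. A function
  \<open>H\<close> almost everywhere in \<open>F\<close> has the same class as some
  \<open>H'\<close> almost everywhere in \<open>G\<close>; by induction \<open>H\<close> and
  \<open>H'\<close> agree almost everywhere. Quantifying over all \<open>H\<close> is the same as
  quantifying over members pointwise, so Extensionality applies at almost every point.\<close>

lemma cls_eqD: "cls U F = cls U G \<Longrightarrow> ae U (\<lambda>x. F x = G x)"
proof -
  have "y = cls U F \<Longrightarrow> y = cls U G \<Longrightarrow> ae U (\<lambda>x. F x = G x)" for y
  proof (induction y arbitrary: F G rule: elts_induct)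
    case (1 y)
    have *: "ae U (\<lambda>x. H x \<in> elts (F' x))"
      if FF': "cls U F = cls U F'" "y = cls U F" and H: "ae U (\<lambda>x. H x \<in> elts (F x))" for H F F'
    proof -
      have "cls U H \<in> elts y" unfolding FF'(2) elts_cls using H by blast
      then obtain H' where H': "cls U H = cls U H'" "ae U (\<lambda>x. H' x \<in> elts (F' x))"
        unfolding FF' elts_cls by blast
      have "ae U (\<lambda>x. H x = H' x)" using 1(1)[OF \<open>cls U H \<in> elts y\<close> refl H'(1)] .
      then have "ae U (\<lambda>x. H x = H' x \<and> H' x \<in> elts (F' x))" using H' by (simp add: ae_conj)
      then show ?thesis by (rule ae_mono) simp
    qed
    have "ae U (\<lambda>x. \<forall>z. z \<in> elts (F x) \<longleftrightarrow> z \<in> elts (G x))"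
      using *[of F G] *[of G F] 1(2,3) by (simp add: ae_all ae_iff) metis
    then show ?case by (rule ae_mono) (auto intro: extensionality)
  qed
  then show "cls U F = cls U G \<Longrightarrow> ae U (\<lambda>x. F x = G x)" by blast
qed

lemma cls_eq_iff: "cls U F = cls U G \<longleftrightarrow> ae U (\<lambda>x. F x = G x)"
  using cls_eqD[of F G] ult_val_cong[of F G] unfolding cls_eq_ult_val by blast

lemma cls_mem_iff: "cls U F \<in> elts (cls U G) \<longleftrightarrow> ae U (\<lambda>x. F x \<in> elts (G x))"
proof
  assume "cls U F \<in> elts (cls U G)"
  then obtain H where "ae U (\<lambda>x. F x = H x)" "ae U (\<lambda>x. H x \<in> elts (G x))"
    by (auto simp: elts_cls cls_eq_iff)
  then have "ae U (\<lambda>x. F x = H x \<and> H x \<in> elts (G x))" by (simp add: ae_conj)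
  then show "ae U (\<lambda>x. F x \<in> elts (G x))" by (rule ae_mono) simp
qed (auto simp: elts_cls)

lemma Ult_UNIV: "Ult UNIV U = range (cls U)"
proof (intro equalityI subsetI)
  fix y assume "y \<in> range (cls U)"
  then obtain F where "y = ult_class UNIV U (lam (base U) F)" by (auto simp: cls_def)
  then show "y \<in> Ult UNIV U" unfolding Ult_def using lam_base_funs by blast
qed (auto simp: Ult_def ult_class_UNIV_cls)

lemma ult_emb_UNIV: "ult_emb UNIV U x = cls U (\<lambda>_. x)"
  by (simp add: ult_emb_def cls_def)

lemma ult_id_UNIV: "ult_id UNIV U = cls U (\<lambda>x. x)"
  by (simp add: ult_id_def cls_def)

end

text \<open>\<open>Q\<close> plays the role of the quantifier "for almost all \<open>x \<in> S\<close>".\<close>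

lemma cc_ultrafilter_quantifier:
  fixes S :: "'v::zfc"
  assumes dom: "Q (\<lambda>x. x \<in> elts S)"
    and mono: "\<And>P P'. Q P \<Longrightarrow> (\<And>x. x \<in> elts S \<Longrightarrow> P x \<Longrightarrow> P' x) \<Longrightarrow> Q P'"
    and conj: "\<And>P P'. Q P \<Longrightarrow> Q P' \<Longrightarrow> Q (\<lambda>x. P x \<and> P' x)"
    and not_False: "\<not> Q (\<lambda>_. False)"
    and not: "\<And>P. Q P \<or> Q (\<lambda>x. \<not> P x)"
    and omega: "\<And>P :: 'v \<Rightarrow> 'v \<Rightarrow> bool. (\<And>m. m \<in> elts omega \<Longrightarrow> Q (P m)) \<Longrightarrow> Q (\<lambda>x. \<forall>m\<in>elts omega. P m x)"
    and V: "V = vset {X. elts X \<subseteq> elts S \<and> Q (\<lambda>x. x \<in> elts X)}"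
  shows "cc_ultrafilter_on UNIV S V" and "base V = S" and "ae V P = Q P"
proof -
  have V': "elts V = {X. elts X \<subseteq> elts S \<and> Q (\<lambda>x. x \<in> elts X)}"
    unfolding V by (rule elts_vset) simp
  have sep: "vset {x \<in> elts S. P x} \<in> elts V \<longleftrightarrow> Q P" for P
  proof -
    have "Q (\<lambda>x. x \<in> elts S \<and> P x) = Q P" using conj[OF dom, of P] mono by blast
    then show ?thesis unfolding V' by auto
  qed
  have "\<not> Q (\<lambda>x. x \<in> elts (vset {}))" using not_False by simp
  then have "ultrafilter_on UNIV S V"
    unfolding ultrafilter_on_def
    using dom
  proof (intro conjI ballI impI)
    fix X assume X: "elts X \<subseteq> elts S"
    have "elts S - elts X = {x \<in> elts S. x \<notin> elts X}" by blast
    then show "X \<in> elts V \<or> vset (elts S - elts X) \<in> elts V"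
      using not[of "\<lambda>x. x \<in> elts X"] X sep[of "\<lambda>x. x \<notin> elts X"] by (auto simp: V')
  qed (auto simp: V' intro: conj mono)
  moreover have "vset {x \<in> elts S. \<forall>n\<in>elts omega. x \<in> elts (app f n)} \<in> elts V"
    if "\<forall>n\<in>elts omega. app f n \<in> elts V" for f
  proof -
    have "Q (\<lambda>x. \<forall>n\<in>elts omega. x \<in> elts (app f n))"
      by (rule omega) (use that in \<open>simp add: V'\<close>)
    then show ?thesis by (simp only: sep)
  qed
  ultimately show "cc_ultrafilter_on UNIV S V" "base V = S" "ae V P = Q P"
    using base_eq[of UNIV S V] sep[of P] by (auto simp: cc_ultrafilter_on_def ae_def)
qed

section \<open>Ultraproducts of classes\<close>

definition uprod :: "'v::zfc \<Rightarrow> ('v \<Rightarrow> 'v set) \<Rightarrow> 'v set" where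
  "uprod U C = cls U ` {F. ae U (\<lambda>x. F x \<in> C x)}"

text \<open>A statement, element or class of the ultraproduct (last argument) is related to a family indexed
  by the base of \<open>U\<close> that represents it. The rules below lift each connective and operation, so that
  Los's theorem for a given notion is obtained by following its definition.\<close>

definition los_prop :: "'v::zfc \<Rightarrow> ('v \<Rightarrow> bool) \<Rightarrow> bool \<Rightarrow> bool" where
  "los_prop U p P \<longleftrightarrow> (P \<longleftrightarrow> ae U p)"

definition los_elem :: "'v::zfc \<Rightarrow> ('v \<Rightarrow> 'v) \<Rightarrow> 'v \<Rightarrow> bool" where
  "los_elem U f y \<longleftrightarrow> y = cls U f"

definition los_class :: "'v::zfc \<Rightarrow> ('v \<Rightarrow> 'v set) \<Rightarrow> 'v set \<Rightarrow> bool" where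
  "los_class U C D \<longleftrightarrow> D = uprod U C"

lemma los_cls: "los_elem U F (cls U F)"
  by (simp add: los_elem_def)

context
  fixes U :: "'v::zfc"
  assumes U: "cc_ultrafilter UNIV U"
begin

lemmas ae_logic = ae_conj[OF U] ae_disj[OF U] ae_imp[OF U] ae_iff[OF U] ae_not[OF U] ae_all[OF U]

lemma cls_uprod_iff: "cls U F \<in> uprod U C \<longleftrightarrow> ae U (\<lambda>x. F x \<in> C x)"
proof
  assume "cls U F \<in> uprod U C"
  then obtain G where "cls U F = cls U G" "ae U (\<lambda>x. G x \<in> C x)" by (auto simp: uprod_def)
  then have "ae U (\<lambda>x. F x = G x \<and> G x \<in> C x)" by (simp add: ae_logic cls_eq_iff[OF U])
  then show "ae U (\<lambda>x. F x \<in> C x)" by (rule ae_mono[OF U]) simp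
qed (auto simp: uprod_def)

lemma cls_lift:
  assumes "\<And>F G. ae U (\<lambda>x. F x = G x) \<Longrightarrow> \<Phi> F = \<Phi> G"
  shows "\<exists>\<rho>. \<forall>F. \<rho> (cls U F) = \<Phi> F"
proof (intro exI allI)
  fix F
  have "cls U F = cls U (SOME G. cls U F = cls U G)" by (rule someI[of _ F]) simp
  then have "ae U (\<lambda>x. (SOME G. cls U F = cls U G) x = F x)"
    unfolding cls_eq_iff[OF U] by (rule ae_mono[OF U]) simp
  then show "(\<lambda>y. \<Phi> (SOME G. y = cls U G)) (cls U F) = \<Phi> F" by (simp add: assms)
qed

lemma uprodE:
  assumes "y \<in> uprod U C" obtains F where "y = cls U F" "ae U (\<lambda>x. F x \<in> C x)"
  using assms by (auto simp: uprod_def)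

lemma los_class_memE:
  assumes "los_class U C D" "y \<in> D" obtains F where "y = cls U F" "ae U (\<lambda>x. F x \<in> C x)"
  using assms by (auto simp: los_class_def elim: uprodE)

lemma los_class_mem_iff: "los_class U C D \<Longrightarrow> cls U F \<in> D \<longleftrightarrow> ae U (\<lambda>x. F x \<in> C x)"
  by (simp add: los_class_def cls_uprod_iff)

lemma uprod_UNIV: "uprod U (\<lambda>_. UNIV) = Ult UNIV U"
  using U by (auto simp: uprod_def Ult_UNIV)

lemma elts_cls_uprod: "elts (cls U F) = uprod U (\<lambda>x. elts (F x))"
  by (simp add: elts_cls[OF U] uprod_def)

lemma los_elts: "los_elem U s S \<Longrightarrow> los_class U (\<lambda>x. elts (s x)) (elts S)"
  by (simp add: los_elem_def los_class_def elts_cls_uprod)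

lemma los_const: "los_prop U (\<lambda>_. P) P"
  by (simp add: los_prop_def ae_const[OF U])

text \<open>If \<open>P\<close> fails, both sides fail whatever \<open>q\<close> and
  \<open>Q\<close> are. Hence the second conjunct may be lifted under the assumption
  \<open>P\<close>, which later provides side conditions such as being a function or a countably
  complete ultrafilter.\<close>

lemma los_conj: "los_prop U p P \<Longrightarrow> (P \<Longrightarrow> los_prop U q Q) \<Longrightarrow> los_prop U (\<lambda>x. p x \<and> q x) (P \<and> Q)"
  by (auto simp: los_prop_def ae_logic)

lemma los_disj: "los_prop U p P \<Longrightarrow> los_prop U q Q \<Longrightarrow> los_prop U (\<lambda>x. p x \<or> q x) (P \<or> Q)"
  by (auto simp: los_prop_def ae_logic)

lemma los_imp: "los_prop U p P \<Longrightarrow> (P \<Longrightarrow> los_prop U q Q) \<Longrightarrow> los_prop U (\<lambda>x. p x \<longrightarrow> q x) (P \<longrightarrow> Q)"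
  by (auto simp: los_prop_def ae_logic)

lemma los_iff: "los_prop U p P \<Longrightarrow> los_prop U q Q \<Longrightarrow> los_prop U (\<lambda>x. p x \<longleftrightarrow> q x) (P \<longleftrightarrow> Q)"
  by (auto simp: los_prop_def ae_logic)

lemma los_not: "los_prop U p P \<Longrightarrow> los_prop U (\<lambda>x. \<not> p x) (\<not> P)"
  by (auto simp: los_prop_def ae_logic)

lemma los_mem: "los_elem U f y \<Longrightarrow> los_class U C D \<Longrightarrow> los_prop U (\<lambda>x. f x \<in> C x) (y \<in> D)"
  by (simp add: los_elem_def los_prop_def los_class_mem_iff)

lemma los_eq: "los_elem U f y \<Longrightarrow> los_elem U g z \<Longrightarrow> los_prop U (\<lambda>x. f x = g x) (y = z)"
  by (simp add: los_elem_def los_prop_def cls_eq_iff[OF U])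

lemma los_bex:
  assumes "los_class U C D" and "\<And>F. cls U F \<in> D \<Longrightarrow> los_prop U (\<lambda>x. q x (F x)) (Q (cls U F))"
  shows "los_prop U (\<lambda>x. \<exists>y\<in>C x. q x y) (\<exists>y\<in>D. Q y)"
proof -
  have "ae U (\<lambda>x. \<exists>y\<in>C x. q x y) \<longleftrightarrow> (\<exists>F. ae U (\<lambda>x. F x \<in> C x \<and> q x (F x)))"
    unfolding Bex_def by (rule ae_ex[OF U])
  also have "\<dots> \<longleftrightarrow> (\<exists>F. cls U F \<in> D \<and> Q (cls U F))"
    using assms(2) by (auto simp: ae_logic los_class_mem_iff[OF assms(1)] los_prop_def)
  also have "\<dots> \<longleftrightarrow> (\<exists>y\<in>D. Q y)"
    using los_class_memE[OF assms(1)] by blast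
  finally show ?thesis by (simp add: los_prop_def)
qed

lemma los_ball:
  assumes "los_class U C D" and "\<And>F. cls U F \<in> D \<Longrightarrow> los_prop U (\<lambda>x. q x (F x)) (Q (cls U F))"
  shows "los_prop U (\<lambda>x. \<forall>y\<in>C x. q x y) (\<forall>y\<in>D. Q y)"
  using los_not[OF los_bex[OF assms(1), of "\<lambda>x y. \<not> q x y" "\<lambda>y. \<not> Q y"]] los_not[OF assms(2)] by simp

lemma los_subset: "los_class U A B \<Longrightarrow> los_class U C D \<Longrightarrow> los_prop U (\<lambda>x. A x \<subseteq> C x) (B \<subseteq> D)"
  unfolding subset_eq by (intro los_ball los_mem los_cls)

lemma los_set_eq: "los_class U A B \<Longrightarrow> los_class U C D \<Longrightarrow> los_prop U (\<lambda>x. A x = C x) (B = D)"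
  unfolding set_eq_subset by (intro los_conj los_subset)

text \<open>An unbounded quantifier on the right ranges over the whole universe, although only
  elements of \<open>Ult UNIV U\<close> have representatives; the second assumption confines the
  witnesses to those.\<close>

lemma los_ex:
  assumes "\<And>F. los_prop U (\<lambda>x. q x (F x)) (Q (cls U F))" and "\<And>y. Q y \<Longrightarrow> y \<in> Ult UNIV U"
  shows "los_prop U (\<lambda>x. \<exists>y. q x y) (\<exists>y. Q y)"
proof -
  have "los_prop U (\<lambda>x. \<exists>y\<in>UNIV. q x y) (\<exists>y\<in>Ult UNIV U. Q y)"
    by (intro los_bex assms(1)) (simp add: los_class_def uprod_UNIV)
  then show ?thesis using assms(2) by (auto simp: los_prop_def)
qed

lemma los_all:
  assumes "\<And>F. los_prop U (\<lambda>x. q x (F x)) (Q (cls U F))" and "\<And>y. \<not> Q y \<Longrightarrow> y \<in> Ult UNIV U"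
  shows "los_prop U (\<lambda>x. \<forall>y. q x y) (\<forall>y. Q y)"
  using los_not[OF los_ex[of "\<lambda>x y. \<not> q x y" "\<lambda>y. \<not> Q y"]] los_not[OF assms(1)] assms(2) by simp

lemma los_ex1:
  assumes "\<And>F. los_prop U (\<lambda>x. q x (F x)) (Q (cls U F))" and "\<And>y. Q y \<Longrightarrow> y \<in> Ult UNIV U"
  shows "los_prop U (\<lambda>x. \<exists>!y. q x y) (\<exists>!y. Q y)"
  unfolding Ex1_def using assms(2)
  by (intro los_ex los_conj los_all los_imp los_eq los_cls assms(1)) auto

lemma los_class_I:
  assumes "\<And>y. y \<in> D \<Longrightarrow> y \<in> Ult UNIV U" and "\<And>F. los_prop U (\<lambda>x. F x \<in> C x) (cls U F \<in> D)"
  shows "los_class U C D"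
proof -
  have "y \<in> D \<longleftrightarrow> y \<in> uprod U C" for y
  proof
    assume "y \<in> D"
    moreover then obtain F where "y = cls U F" using assms(1) by (auto simp: Ult_UNIV[OF U])
    ultimately show "y \<in> uprod U C" using assms(2) by (simp add: los_prop_def cls_uprod_iff)
  next
    assume "y \<in> uprod U C"
    then show "y \<in> D" using assms(2) by (auto elim!: uprodE simp: los_prop_def)
  qed
  then show ?thesis by (auto simp: los_class_def)
qed

lemma los_class_UNIV: "los_class U (\<lambda>_. UNIV) (Ult UNIV U)"
  by (simp add: los_class_def uprod_UNIV)

lemma los_class_subset_Ult: "los_class U C D \<Longrightarrow> y \<in> D \<Longrightarrow> y \<in> Ult UNIV U"
  by (auto elim!: los_class_memE simp: Ult_UNIV[OF U])

lemma los_elem_Ult: "los_elem U f y \<Longrightarrow> y \<in> Ult UNIV U"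
  by (simp add: los_elem_def Ult_UNIV[OF U])

lemma Ult_trans: "x \<in> Ult UNIV U \<Longrightarrow> y \<in> elts x \<Longrightarrow> y \<in> Ult UNIV U"
  by (auto simp: Ult_UNIV[OF U] elts_cls[OF U])

lemma los_empty: "los_class U (\<lambda>_. {}) {}"
  by (rule los_class_I) (simp_all add: los_const)

lemma los_insert: "los_elem U f y \<Longrightarrow> los_class U C D \<Longrightarrow> los_class U (\<lambda>x. insert (f x) (C x)) (insert y D)"
  by (rule los_class_I, use los_elem_Ult los_class_subset_Ult in blast)
    (simp only: insert_iff, intro los_disj los_eq los_mem los_cls)

lemma los_Int: "los_class U A B \<Longrightarrow> los_class U C D \<Longrightarrow> los_class U (\<lambda>x. A x \<inter> C x) (B \<inter> D)"
  by (rule los_class_I, use los_class_subset_Ult in blast) (simp only: Int_iff, intro los_conj los_mem los_cls)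

lemma los_Diff: "los_class U A B \<Longrightarrow> los_class U C D \<Longrightarrow> los_class U (\<lambda>x. A x - C x) (B - D)"
  by (rule los_class_I, use los_class_subset_Ult in blast) (simp only: Diff_iff, intro los_conj los_not los_mem los_cls)

lemma los_Collect:
  assumes C: "los_class U C D" and "\<And>F. cls U F \<in> D \<Longrightarrow> los_prop U (\<lambda>x. p x (F x)) (P (cls U F))"
  shows "los_class U (\<lambda>x. {y \<in> C x. p x y}) {y \<in> D. P y}"
  using assms(2) by (intro los_class_I) (auto simp: los_class_subset_Ult[OF C] intro!: los_conj los_mem los_cls C)

lemma los_Collect2:
  assumes "\<And>F. los_prop U (\<lambda>x. p x (F x)) (P (cls U F))" "\<And>y. P y \<Longrightarrow> y \<in> Ult UNIV U"
  shows "los_class U (\<lambda>x. {y. p x y}) {y. P y}"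
  using assms by (intro los_class_I) auto

lemma los_UN:
  assumes "los_class U C D" and "\<And>F. cls U F \<in> D \<Longrightarrow> los_class U (\<lambda>x. B x (F x)) (B' (cls U F))"
  shows "los_class U (\<lambda>x. \<Union>y\<in>C x. B x y) (\<Union>y\<in>D. B' y)"
proof (rule los_class_I)
  fix y assume "y \<in> (\<Union>y\<in>D. B' y)"
  then show "y \<in> Ult UNIV U" using assms(2) by (auto elim!: los_class_memE[OF assms(1)] intro: los_class_subset_Ult
    simp: los_class_mem_iff[OF assms(1)])
next
  fix F show "los_prop U (\<lambda>x. F x \<in> (\<Union>y\<in>C x. B x y)) (cls U F \<in> (\<Union>y\<in>D. B' y))"
    unfolding UN_iff by (intro los_bex los_mem los_cls assms)
qed

lemma los_image:
  assumes "los_class U C D" and "\<And>F. cls U F \<in> D \<Longrightarrow> los_elem U (\<lambda>x. h x (F x)) (H (cls U F))"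
  shows "los_class U (\<lambda>x. h x ` C x) (H ` D)"
proof -
  have "los_class U (\<lambda>x. \<Union>y\<in>C x. {h x y}) (\<Union>y\<in>D. {H y})"
    by (intro los_UN los_insert los_empty assms)
  then show ?thesis by (simp add: UNION_singleton_eq_range)
qed

lemma los_vset:
  assumes "los_class U C D" "\<And>x. small (C x)" shows "los_elem U (\<lambda>x. vset (C x)) (vset D)"
proof -
  have "elts (cls U (\<lambda>x. vset (C x))) = D"
    using assms by (simp add: elts_cls_uprod los_class_def)
  then show ?thesis by (metis los_elem_def vset_elts)
qed

lemmas los_basic = los_elts los_conj los_disj los_imp los_iff los_not los_mem los_eq los_bex los_ball los_subset
  los_empty los_insert los_Int los_Diff los_Collect los_UN los_image los_vset los_cls

section \<open>Los's theorem for pairs, functions, ordinals, finite sets and ultrafilters\<close>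

lemma los_opair: "los_elem U f y \<Longrightarrow> los_elem U g z \<Longrightarrow> los_elem U (\<lambda>x. opair (f x) (g x)) (opair y z)"
  unfolding opair_def by (intro los_basic) simp_all

lemma opair_Ult: "opair x y \<in> Ult UNIV U \<Longrightarrow> x \<in> Ult UNIV U \<and> y \<in> Ult UNIV U"
proof -
  assume *: "opair x y \<in> Ult UNIV U"
  have "vset {x, y} \<in> elts (opair x y)" by (simp add: opair_def)
  then have "vset {x, y} \<in> Ult UNIV U" using * Ult_trans by blast
  then show ?thesis using Ult_trans[of "vset {x, y}"] by simp
qed

lemma los_is_fun_on:
  assumes f: "los_elem U f f'" and S: "los_elem U S S'"
  shows "los_prop U (\<lambda>x. is_fun_on (f x) (S x)) (is_fun_on f' S')"
  unfolding is_fun_on_def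
proof (intro los_basic los_ex los_ex1 los_opair f S)
  fix p q y assume "cls U p = opair (cls U q) y"
  then show "y \<in> Ult UNIV U" using opair_Ult[of "cls U q" y] by (simp add: Ult_UNIV[OF U] image_iff) metis
next
  fix q y assume "opair (cls U q) y \<in> elts f'"
  then show "y \<in> Ult UNIV U" using los_elem_Ult[OF f] Ult_trans opair_Ult by blast
qed

text \<open>As a definite description, \<open>app\<close> can be followed only where a value exists.
  By Los, \<open>f x\<close> is a function defined at \<open>a x\<close> for almost all
  \<open>x\<close>, so the pair with \<open>app (f x) (a x)\<close> lies in \<open>f x\<close>, and
  this membership statement lifts.\<close>

lemma los_app:
  assumes f: "los_elem U f f'" and a: "los_elem U a a'" and f_fun: "is_fun_on f' S'" and S: "los_elem U S S'"
    and mem: "a' \<in> elts S'"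
  shows "los_elem U (\<lambda>x. app (f x) (a x)) (app f' a')"
proof -
  have "ae U (\<lambda>x. is_fun_on (f x) (S x) \<and> a x \<in> elts (S x))"
    using f_fun mem los_is_fun_on[OF f S] los_mem[OF a los_elts[OF S]] by (simp add: los_prop_def ae_logic)
  then have "ae U (\<lambda>x. opair (a x) (app (f x) (a x)) \<in> elts (f x))"
    by (rule ae_mono[OF U]) (elim conjE, rule app_mem)
  moreover have "los_prop U (\<lambda>x. opair (a x) (app (f x) (a x)) \<in> elts (f x))
      (opair a' (cls U (\<lambda>x. app (f x) (a x))) \<in> elts f')"
    by (intro los_basic los_opair f a)
  ultimately show ?thesis using app_eqI[OF f_fun] by (simp add: los_prop_def los_elem_def)
qed

lemma los_lam:
  assumes S: "los_elem U S S'"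
    and "\<And>F. cls U F \<in> elts S' \<Longrightarrow> los_elem U (\<lambda>x. h x (F x)) (H (cls U F))"
  shows "los_elem U (\<lambda>x. lam (S x) (h x)) (lam S' H)"
  unfolding lam_def by (intro los_basic los_opair assms) simp_all

lemma los_transset: "los_elem U f y \<Longrightarrow> los_prop U (\<lambda>x. transset (f x)) (transset y)"
  unfolding transset_def by (intro los_basic)

lemma los_ordinal: "los_elem U f y \<Longrightarrow> los_prop U (\<lambda>x. ordinal (f x)) (ordinal y)"
  unfolding ordinal_def by (intro los_basic los_transset)

text \<open>Removing one element at a time expresses "finite with \<open>n\<close> elements", for a
  fixed numeral \<open>n\<close>, by connectives that are already known to lift.\<close>

lemma card_Suc_iff_mem:
  "finite A \<and> card A = Suc n \<longleftrightarrow> (\<exists>z\<in>A. finite (A - {z}) \<and> card (A - {z}) = n)"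
  by (metis Suc_inject card_Suc_Diff1 card_eq_SucD finite_Diff_insert finite_insert insertCI insert_Diff)

lemma los_card:
  "los_elem U f y \<Longrightarrow> los_prop U (\<lambda>x. finite (elts (f x)) \<and> card (elts (f x)) = n)
    (finite (elts y) \<and> card (elts y) = n)"
proof (induction n arbitrary: f y)
  case 0
  have "finite A \<and> card A = 0 \<longleftrightarrow> A \<subseteq> {}" for A :: "'v set" by auto
  then show ?case using 0 by (simp only:) (intro los_basic)
next
  case (Suc n)
  have eq: "finite (elts a - {z}) \<and> card (elts a - {z}) = n \<longleftrightarrow>
      finite (elts (vset (elts a - {z}))) \<and> card (elts (vset (elts a - {z}))) = n" for a z :: 'v
    by simp
  show ?case unfolding card_Suc_iff_mem eq
    by (intro los_bex Suc.IH los_basic Suc.prems) simp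
qed

text \<open>\<open>nsubsets\<close> is computed in the universe; closure of the ultrapower under
  finite subsets ensures that all its members are represented, which is what
  \<open>los_nsubsets\<close> needs.\<close>

lemma finite_mem_Ult:
  assumes "finite A" "A \<subseteq> Ult UNIV U" shows "vset A \<in> Ult UNIV U"
  using assms
proof (induction rule: finite_induct)
  case empty
  show ?case by (rule los_elem_Ult[OF los_vset[OF los_empty small_empty]])
next
  case (insert a A)
  then obtain f g where "a = cls U f" "vset A = cls U g" by (auto simp: Ult_UNIV[OF U])
  then have "los_elem U f a" "los_elem U g (vset A)" by (simp_all add: los_elem_def)
  then have "los_elem U (\<lambda>x. vset (insert (f x) (elts (g x)))) (vset (insert a (elts (vset A))))"
    by (intro los_basic) simp_all
  then show ?case using los_elem_Ult small_finite[OF insert(1)] by simp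
qed

lemma los_nsubsets:
  assumes "los_elem U f y" shows "los_elem U (\<lambda>x. nsubsets (f x) n) (nsubsets y n)"
  unfolding nsubsets_def
proof (rule los_vset[OF los_Collect2])
  show "los_prop U (\<lambda>x. elts (F x) \<subseteq> elts (f x) \<and> finite (elts (F x)) \<and> card (elts (F x)) = n)
    (elts (cls U F) \<subseteq> elts y \<and> finite (elts (cls U F)) \<and> card (elts (cls U F)) = n)" for F
    by (rule los_conj, intro los_subset los_elts los_cls assms, rule los_card, rule los_cls)
next
  fix a assume a: "elts a \<subseteq> elts y \<and> finite (elts a) \<and> card (elts a) = n"
  then have "elts a \<subseteq> Ult UNIV U" using Ult_trans los_elem_Ult[OF assms] by blast
  then show "a \<in> Ult UNIV U" using finite_mem_Ult[of "elts a"] a by simp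
qed simp

text \<open>A function into a finite set is constant almost everywhere, so the embedding adds no new
  members to a finite set.\<close>

lemma cls_finite:
  assumes "finite (elts a)"
  shows "elts (cls U (\<lambda>_. a)) = (\<lambda>y. cls U (\<lambda>_. y)) ` elts a"
proof -
  have fin: "finite A \<Longrightarrow> ae U (\<lambda>x. F x \<in> A) \<longleftrightarrow> (\<exists>y\<in>A. ae U (\<lambda>x. F x = y))" for F :: "'v \<Rightarrow> 'v" and A
    by (induction rule: finite_induct) (auto simp: ae_logic ae_const[OF U])
  show ?thesis
  proof (intro equalityI subsetI)
    fix z assume "z \<in> elts (cls U (\<lambda>_. a))"
    then show "z \<in> (\<lambda>y. cls U (\<lambda>_. y)) ` elts a"
      using fin[OF assms] by (auto simp: elts_cls[OF U] cls_eq_iff[OF U] image_iff)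
  qed (auto simp: cls_mem_iff[OF U] ae_const[OF U])
qed

lemma los_vnat: "los_elem U (\<lambda>_. vnat n) (vnat n)"
proof (induction n)
  case 0
  show ?case unfolding vnat.simps by (intro los_basic) simp
next
  case (Suc n)
  then show ?case unfolding vnat.simps by (intro los_basic) simp_all
qed

text \<open>By countable completeness a function into \<open>omega\<close> is constant almost
  everywhere, and each \<open>vnat n\<close> is fixed by the embedding; hence \<open>omega\<close>
  is fixed too.\<close>

lemma los_omega: "los_elem U (\<lambda>_. omega) omega"
proof -
  have "cls U F \<in> elts (cls U (\<lambda>_. omega)) \<longleftrightarrow> cls U F \<in> elts omega" for F
  proof
    assume "cls U F \<in> elts (cls U (\<lambda>_. omega))"
    then have *: "ae U (\<lambda>x. F x \<in> elts omega)" by (simp add: cls_mem_iff[OF U])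
    have "\<exists>n. ae U (\<lambda>x. F x = vnat n)"
    proof (rule ccontr)
      assume "\<not> ?thesis"
      then have "ae U (\<lambda>x. \<forall>n. F x \<noteq> vnat n)" by (simp add: ae_nat[OF U] ae_logic)
      then have "ae U (\<lambda>x. (\<forall>n. F x \<noteq> vnat n) \<and> F x \<in> elts omega)"
        using * by (subst ae_conj[OF U]) (rule conjI)
      then have "ae U (\<lambda>x. False)" by (rule ae_mono[OF U]) (auto simp: elts_omega)
      then show False by (simp add: ae_const[OF U])
    qed
    then obtain n where "cls U F = cls U (\<lambda>_. vnat n)" by (auto simp: cls_eq_iff[OF U])
    then show "cls U F \<in> elts omega" using los_vnat[of n] by (auto simp: los_elem_def elts_omega)
  next
    assume "cls U F \<in> elts omega"
    then obtain n where "cls U F = cls U (\<lambda>_. vnat n)"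
      using los_vnat by (auto simp: elts_omega los_elem_def)
    then show "cls U F \<in> elts (cls U (\<lambda>_. omega))"
      by (simp add: cls_mem_iff[OF U] ae_const[OF U] elts_omega)
  qed
  moreover have "elts omega \<subseteq> range (cls U)"
    using los_vnat by (auto simp: elts_omega los_elem_def)
  moreover have "elts (cls U (\<lambda>_. omega)) \<subseteq> range (cls U)" by (auto simp: elts_cls[OF U])
  ultimately have "elts omega = elts (cls U (\<lambda>_. omega))" by (intro equalityI subsetI) blast+
  then show ?thesis by (simp add: los_elem_def extensionality)
qed

lemma los_base: "los_elem U W W' \<Longrightarrow> los_elem U (\<lambda>x. base (W x)) (base W')"
  unfolding base_def by (intro los_basic) simp_all

lemma los_ultrafilter_on:
  "los_class U C C' \<Longrightarrow> los_elem U S S' \<Longrightarrow> los_elem U W W' \<Longrightarrow>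
    los_prop U (\<lambda>x. ultrafilter_on (C x) (S x) (W x)) (ultrafilter_on C' S' W')"
  unfolding ultrafilter_on_def by (intro los_basic) simp_all

lemma los_cc_ultrafilter_on:
  assumes "los_class U C C'" "los_elem U S S'" "los_elem U W W'"
  shows "los_prop U (\<lambda>x. cc_ultrafilter_on (C x) (S x) (W x)) (cc_ultrafilter_on C' S' W')"
  unfolding cc_ultrafilter_on_def
  by (intro los_basic los_ultrafilter_on los_is_fun_on los_omega los_app[OF _ _ _ los_omega] assms) auto

lemma los_cc_ultrafilter:
  assumes C: "los_class U C C'" and W: "los_elem U W W'"
  shows "los_prop U (\<lambda>x. cc_ultrafilter (C x) (W x)) (cc_ultrafilter C' W')"
  unfolding cc_ultrafilter_def
proof (intro los_ex los_cc_ultrafilter_on los_basic assms)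
  fix S assume "cc_ultrafilter_on C' S W'"
  then show "S \<in> Ult UNIV U"
    by (intro los_class_subset_Ult[OF C]) (simp add: cc_ultrafilter_on_def ultrafilter_on_def)
qed

lemma los_ult_funs:
  assumes "los_class U C C'" "los_elem U W W'"
  shows "los_class U (\<lambda>x. ult_funs (C x) (W x)) (ult_funs C' W')"
  unfolding ult_funs_def by (intro los_basic los_is_fun_on los_base assms)

end

section \<open>Ultrapowers of inner models\<close>

text \<open>\<open>ult_class\<close> is a definite description over equivalence classes and cannot
  be followed by the lifting rules. These conditions on a map of representatives can, and they pin
  down \<open>ult_class\<close> by \<open>ult_solution_class\<close>.\<close>

definition ult_solution :: "'v::zfc set \<Rightarrow> 'v \<Rightarrow> ('v \<Rightarrow> 'v) \<Rightarrow> bool" where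
  "ult_solution M W \<pi> \<longleftrightarrow> base W \<in> elts W \<and>
     (\<forall>f\<in>ult_funs M W. \<forall>g\<in>ult_funs M W.
        vset {x \<in> elts (base W). app f x = app g x} \<in> elts W \<longleftrightarrow> \<pi> f = \<pi> g) \<and>
     (\<forall>f\<in>ult_funs M W. elts (\<pi> f) = \<pi> ` {g \<in> ult_funs M W.
        vset {x \<in> elts (base W). app g x \<in> elts (app f x)} \<in> elts W})"

definition well_ult :: "'v::zfc set \<Rightarrow> 'v \<Rightarrow> bool" where
  "well_ult M W \<longleftrightarrow> ult_solution M W (ult_class M W)"

definition lam_closed :: "'v::zfc set \<Rightarrow> bool" where
  "lam_closed M \<longleftrightarrow> (\<forall>S\<in>M. lam S (\<lambda>x. x) \<in> M \<and> (\<forall>z\<in>M. lam S (\<lambda>_. z) \<in> M))"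

text \<open>What is extracted from "inner model of ZFC": constant and identity functions, so that
  embeddings and seeds have representatives, and well-defined collapses of the internal ultrapowers.
  Unlike satisfaction of ZFC, this passes to ultraproducts by the rules above.\<close>

definition inner :: "'v::zfc set \<Rightarrow> bool" where
  "inner M \<longleftrightarrow> lam_closed M \<and> (\<forall>W\<in>M. cc_ultrafilter M W \<longrightarrow> well_ult M W)"

lemma ult_solution_class:
  assumes "ult_solution M W \<pi>" "f \<in> ult_funs M W"
  shows "ult_class M W f = \<pi> f"
proof (rule ult_class_eq[OF _ _ _ assms(2)])
  show "base W \<in> elts W" using assms(1) by (simp add: ult_solution_def)
  show "\<pi> f = \<pi> g" if "(f, g) \<in> ult_eq M W" for f g
    using that assms(1) by (auto simp: ult_solution_def ult_eq_def)
qed (use assms(1) in \<open>simp add: ult_solution_def\<close>)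

lemma ult_solution_well:
  assumes "ult_solution M W \<pi>" shows "well_ult M W"
proof -
  have "ult_class M W ` {g \<in> ult_funs M W. P g} = \<pi> ` {g \<in> ult_funs M W. P g}" for P
    by (rule image_cong) (auto simp: ult_solution_class[OF assms])
  then show ?thesis
    using assms ult_solution_class[OF assms] unfolding well_ult_def ult_solution_def by simp
qed

lemma cc_ultrafilter_mem: "cc_ultrafilter M W \<Longrightarrow> W \<in> M \<and> base W \<in> M"
  using cc_ultrafilter_base[of M W] ultrafilter_onD(1,2) by (auto simp: cc_ultrafilter_on_def)

lemma inner_well: "inner M \<Longrightarrow> cc_ultrafilter M W \<Longrightarrow> well_ult M W"
  using cc_ultrafilter_mem by (auto simp: inner_def)

lemma inner_UNIV: "inner (UNIV :: 'v::zfc set)"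
proof -
  have "well_ult UNIV W" if W: "cc_ultrafilter UNIV W" for W :: 'v
  proof (rule ult_solution_well[of _ _ "\<lambda>f. cls W (app f)"])
    show "ult_solution UNIV W (\<lambda>f. cls W (app f))"
      unfolding ult_solution_def cls_eq_iff[OF W] ae_def[symmetric]
    proof (intro conjI ballI refl base_mem_uf[OF W])
      fix f assume f: "f \<in> ult_funs UNIV W"
      have "\<exists>h\<in>ult_funs UNIV W. y = cls W (app h) \<and> ae W (\<lambda>x. app h x \<in> elts (app f x))"
        if y: "y \<in> elts (cls W (app f))" for y
      proof -
        obtain G where G: "y = cls W G" "ae W (\<lambda>x. G x \<in> elts (app f x))"
          using y by (auto simp: elts_cls[OF W])
        have "ae W (\<lambda>x. G x = app (lam (base W) G) x)"
          using ae_base[OF W] by (rule ae_mono[OF W]) simp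
        then have "y = cls W (app (lam (base W) G))" using G by (simp add: cls_eq_iff[OF W])
        moreover then have "ae W (\<lambda>x. app (lam (base W) G) x \<in> elts (app f x))"
          using y by (simp add: cls_mem_iff[OF W])
        ultimately show ?thesis using lam_base_funs by blast
      qed
      then show "elts (cls W (app f)) = (\<lambda>f. cls W (app f)) `
          {g \<in> ult_funs UNIV W. ae W (\<lambda>x. app g x \<in> elts (app f x))}"
        by (auto simp: cls_mem_iff[OF W])
    qed
  qed
  then show ?thesis by (simp add: inner_def lam_closed_def)
qed

lemma lam_funs:
  assumes "inner M" "cc_ultrafilter M W"
  shows "x \<in> M \<Longrightarrow> lam (base W) (\<lambda>_. x) \<in> ult_funs M W" and "lam (base W) (\<lambda>x. x) \<in> ult_funs M W"
  using assms cc_ultrafilter_mem[of M W] by (auto simp: inner_def lam_closed_def ult_funs_def)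

lemma ult_emb_Ult: "inner M \<Longrightarrow> cc_ultrafilter M W \<Longrightarrow> x \<in> M \<Longrightarrow> ult_emb M W x \<in> Ult M W"
  by (simp add: ult_emb_def Ult_def lam_funs)

lemma ult_id_Ult: "inner M \<Longrightarrow> cc_ultrafilter M W \<Longrightarrow> ult_id M W \<in> Ult M W"
  by (simp add: ult_id_def Ult_def lam_funs)

context
  fixes U :: "'v::zfc"
  assumes U: "cc_ultrafilter UNIV U"
begin

lemmas los = los_elts[OF U] los_conj[OF U] los_disj[OF U] los_imp[OF U] los_iff[OF U] los_not[OF U] los_mem[OF U]
  los_eq[OF U] los_bex[OF U] los_ball[OF U] los_subset[OF U] los_set_eq[OF U] los_empty[OF U] los_insert[OF U]
  los_Int[OF U] los_Diff[OF U] los_Collect[OF U] los_UN[OF U] los_image[OF U] los_vset[OF U] los_cls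
  los_base[OF U] los_lam[OF U]

lemma los_ult_solution:
  assumes CW: "los_class U C C'" "los_elem U W W'"
    and \<pi>: "\<And>F. cls U F \<in> ult_funs C' W' \<Longrightarrow> los_elem U (\<lambda>x. \<pi> x (F x)) (\<rho> (cls U F))"
  shows "los_prop U (\<lambda>x. ult_solution (C x) (W x) (\<pi> x)) (ult_solution C' W' \<rho>)"
proof -
  have app: "los_elem U (\<lambda>x. app (F x) (a x)) (app (cls U F) (cls U a))"
    if "cls U F \<in> ult_funs C' W'" "cls U a \<in> elts (base W')" for F a
    using that by (intro los_app[OF U _ _ _ los_base[OF U CW(2)]] los) (auto simp: ult_funs_def)
  show ?thesis unfolding ult_solution_def
    by (intro los los_ult_funs[OF U] CW \<pi> app) auto
qed

lemma los_lam_closed: "los_class U C C' \<Longrightarrow> los_prop U (\<lambda>x. lam_closed (C x)) (lam_closed C')"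
  unfolding lam_closed_def by (intro los)

context
  fixes C C' W W'
  assumes C: "los_class U C C'" and W: "los_elem U W W'"
    and inner: "ae U (\<lambda>x. inner (C x))" and cc: "cc_ultrafilter C' W'"
begin

lemma ae_cc: "ae U (\<lambda>x. cc_ultrafilter (C x) (W x))"
  using cc los_cc_ultrafilter[OF U C W] by (simp add: los_prop_def)

lemma ult_solution_uprod:
  "\<exists>\<rho>. ult_solution C' W' \<rho> \<and> (\<forall>F. \<rho> (cls U F) = cls U (\<lambda>x. ult_class (C x) (W x) (F x)))"
proof -
  have "\<exists>\<rho>. \<forall>F. \<rho> (cls U F) = cls U (\<lambda>x. ult_class (C x) (W x) (F x))"
    by (rule cls_lift[OF U]) (auto simp: cls_eq_iff[OF U] elim: ae_mono[OF U])
  then obtain \<rho> where \<rho>: "\<And>F. \<rho> (cls U F) = cls U (\<lambda>x. ult_class (C x) (W x) (F x))"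
    by blast
  have "ae U (\<lambda>x. inner (C x) \<and> cc_ultrafilter (C x) (W x))" using inner ae_cc by (simp add: ae_logic[OF U])
  then have "ae U (\<lambda>x. ult_solution (C x) (W x) (ult_class (C x) (W x)))"
    by (rule ae_mono[OF U]) (simp add: inner_well flip: well_ult_def)
  moreover have "los_prop U (\<lambda>x. ult_solution (C x) (W x) (ult_class (C x) (W x))) (ult_solution C' W' \<rho>)"
    by (rule los_ult_solution[OF C W]) (simp add: \<rho> los_elem_def)
  ultimately show ?thesis using \<rho> by (auto simp: los_prop_def)
qed

lemma well_ult_uprod: "well_ult C' W'"
  using ult_solution_uprod ult_solution_well by blast

lemma los_ult_class:
  assumes "los_elem U f f'" "f' \<in> ult_funs C' W'"
  shows "los_elem U (\<lambda>x. ult_class (C x) (W x) (f x)) (ult_class C' W' f')"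
  using ult_solution_uprod ult_solution_class[OF _ assms(2)] assms(1) by (auto simp: los_elem_def)

lemma los_Ult: "los_class U (\<lambda>x. Ult (C x) (W x)) (Ult C' W')"
  unfolding Ult_def by (intro los_image[OF U] los_ult_funs[OF U] C W los_ult_class los_cls)

lemma lam_closed_uprod: "lam_closed C'"
  using los_lam_closed[OF C] inner by (auto simp: los_prop_def inner_def elim: ae_mono[OF U])

lemma los_ult_emb:
  assumes f: "los_elem U f f'" "f' \<in> C'"
  shows "los_elem U (\<lambda>x. ult_emb (C x) (W x) (f x)) (ult_emb C' W' f')"
  unfolding ult_emb_def
  by (intro los_ult_class los W f) (use lam_closed_uprod cc_ultrafilter_mem[OF cc] f
    in \<open>auto simp: ult_funs_def lam_closed_def\<close>)

lemma los_ult_id: "los_elem U (\<lambda>x. ult_id (C x) (W x)) (ult_id C' W')"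
  unfolding ult_id_def
  by (intro los_ult_class los W) (use lam_closed_uprod cc_ultrafilter_mem[OF cc]
    in \<open>auto simp: ult_funs_def lam_closed_def\<close>)

end

lemma inner_uprod:
  assumes C: "los_class U C C'" and inner: "ae U (\<lambda>x. inner (C x))"
  shows "inner C'"
proof -
  have "lam_closed C'"
    using los_lam_closed[OF C] inner by (auto simp: los_prop_def inner_def elim: ae_mono[OF U])
  moreover have "well_ult C' W'" if "W' \<in> C'" "cc_ultrafilter C' W'" for W'
    using los_class_memE[OF U C that(1)] well_ult_uprod[OF C los_cls inner] that(2) by metis
  ultimately show ?thesis by (simp add: inner_def)
qed

lemma inner_Ult: "inner (Ult UNIV U)"
  by (rule inner_uprod[OF los_class_UNIV[OF U]]) (simp add: ae_const[OF U] inner_UNIV)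

lemma Ult_los_elem: "y \<in> Ult UNIV U \<Longrightarrow> \<exists>f. los_elem U f y"
  by (auto simp: Ult_UNIV[OF U] los_elem_def)

end

section \<open>Iterated ultrapowers\<close>

lemma cls_unique:
  assumes U: "cc_ultrafilter UNIV U"
    and \<rho>: "\<And>F. elts (\<rho> F) = \<rho> ` {G. ae U (\<lambda>x. G x \<in> elts (F x))}"
  shows "cls U F = \<rho> F"
proof (induction F rule: wf_induct_rule[OF wf_ae_mem[OF U]])
  case (1 F)
  have "cls U ` {G. ae U (\<lambda>x. G x \<in> elts (F x))} = \<rho> ` {G. ae U (\<lambda>x. G x \<in> elts (F x))}"
    by (rule image_cong) (use 1 in auto)
  then show ?case by (intro extensionality) (simp add: \<rho> elts_cls[OF U])
qed

text \<open>\<open>D\<close> is the \<open>W\<close>-sum of the ultrafilters \<open>k x\<close>, on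
  the set of pairs \<open>opair x y\<close> with \<open>y\<close> in
  \<open>base (k x)\<close>.\<close>

lemma sum_ultrafilter:
  fixes W :: "'v::zfc"
  assumes W: "cc_ultrafilter UNIV W" and k: "ae W (\<lambda>x. cc_ultrafilter UNIV (k x))"
  shows "\<exists>D. cc_ultrafilter UNIV D \<and> (\<forall>P. ae D P \<longleftrightarrow> ae W (\<lambda>x. ae (k x) (\<lambda>y. P (opair x y))))"
proof -
  define S where "S = vset (\<Union>x\<in>elts (base W). \<Union>y\<in>elts (base (k x)). {opair x y})"
  have S: "elts S = (\<Union>x\<in>elts (base W). \<Union>y\<in>elts (base (k x)). {opair x y})"
    unfolding S_def by (intro elts_vset small_UN small_elts small_insert small_empty)
  define Q where "Q P \<longleftrightarrow> ae W (\<lambda>x. ae (k x) (\<lambda>y. P (opair x y)))" for P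
  have kW: "ae W (\<lambda>x. cc_ultrafilter UNIV (k x) \<and> P x) \<longleftrightarrow> ae W P" for P
    using k by (simp add: ae_conj[OF W])
  \<comment> \<open>\<open>k x\<close> is an ultrafilter only for almost all \<open>x\<close>; this
    form of monotonicity supplies that fact pointwise.\<close>
  have monoW: "ae W P'" if "ae W P"
    "\<And>x. x \<in> elts (base W) \<Longrightarrow> cc_ultrafilter UNIV (k x) \<Longrightarrow> P x \<Longrightarrow> P' x" for P P'
    using that kW[of P] ae_mono[OF W, of "\<lambda>x. cc_ultrafilter UNIV (k x) \<and> P x" P'] by blast
  define D where "D = vset {X. elts X \<subseteq> elts S \<and> Q (\<lambda>p. p \<in> elts X)}"
  have dom: "Q (\<lambda>p. p \<in> elts S)"
    unfolding Q_def by (rule monoW[OF ae_base[OF W]], rule ae_mono[OF _ ae_base]) (auto simp: S)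
  have mono: "Q P'" if "Q P" and *: "\<And>p. p \<in> elts S \<Longrightarrow> P p \<Longrightarrow> P' p" for P P'
    using that(1) unfolding Q_def
  proof (rule monoW)
    fix x assume x: "x \<in> elts (base W)" "cc_ultrafilter UNIV (k x)" "ae (k x) (\<lambda>y. P (opair x y))"
    show "ae (k x) (\<lambda>y. P' (opair x y))"
      by (rule ae_mono[OF x(2,3)]) (use * x in \<open>auto simp: S\<close>)
  qed
  have conj: "Q (\<lambda>p. P p \<and> P' p)" if "Q P" "Q P'" for P P'
  proof -
    have "ae W (\<lambda>x. ae (k x) (\<lambda>y. P (opair x y)) \<and> ae (k x) (\<lambda>y. P' (opair x y)))"
      using that by (simp add: Q_def ae_conj[OF W])
    then show ?thesis unfolding Q_def by (rule monoW) (simp add: ae_conj)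
  qed
  have not_False: "\<not> Q (\<lambda>_. False)"
    using monoW[of "\<lambda>x. ae (k x) (\<lambda>_. False)" "\<lambda>_. False"]
    by (auto simp: Q_def ae_const ae_const[OF W])
  have not: "Q P \<or> Q (\<lambda>p. \<not> P p)" for P
  proof (rule disjCI)
    assume "\<not> Q (\<lambda>p. \<not> P p)"
    then have "ae W (\<lambda>x. \<not> ae (k x) (\<lambda>y. \<not> P (opair x y)))" by (simp add: Q_def ae_not[OF W])
    then show "Q P" unfolding Q_def by (rule monoW) (simp add: ae_not)
  qed
  have omega: "Q (\<lambda>p. \<forall>m\<in>elts omega. P m p)"
    if "\<And>m. m \<in> elts omega \<Longrightarrow> Q (P m)" for P :: "'v \<Rightarrow> 'v \<Rightarrow> bool"
  proof -
    have "ae W (\<lambda>x. \<forall>m\<in>elts omega. ae (k x) (\<lambda>y. P m (opair x y)))"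
      using that unfolding Q_def by (rule ae_omega[OF W])
    then show ?thesis unfolding Q_def by (rule monoW) (simp add: ae_omega)
  qed
  have D: "cc_ultrafilter_on UNIV S D" and ae_D: "ae D P = Q P" for P
    by (rule cc_ultrafilter_quantifier[where Q = Q and S = S and V = D];
        fact dom mono conj not_False not omega D_def)+
  have "cc_ultrafilter UNIV D" using D unfolding cc_ultrafilter_def by blast
  then show ?thesis using ae_D unfolding Q_def by blast
qed

definition same_ult :: "'v::zfc set \<Rightarrow> 'v \<Rightarrow> 'v \<Rightarrow> 'v \<Rightarrow> bool" where
  "same_ult M W K D \<longleftrightarrow> cc_ultrafilter M D \<and> Ult (Ult M W) K = Ult M D \<and>
     (\<forall>x\<in>M. ult_emb (Ult M W) K (ult_emb M W x) = ult_emb M D x)"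

text \<open>For \<open>K\<close> represented by \<open>k\<close>, the two-step ultrapower is the
  ultrapower by the \<open>W\<close>-sum \<open>D\<close> of the ultrafilters
  \<open>k x\<close>.\<close>

lemma iterated_ultrapower_UNIV:
  fixes W :: "'v::zfc"
  assumes W: "cc_ultrafilter UNIV W" and K: "cc_ultrafilter (Ult UNIV W) K"
  shows "\<exists>D\<in>UNIV. same_ult UNIV W K D"
proof -
  obtain k where k: "los_elem W k K" using cc_ultrafilter_mem[OF K] Ult_los_elem[OF W] by blast
  have ink: "ae W (\<lambda>_. inner UNIV)" by (simp add: ae_const[OF W] inner_UNIV)
  note TK = los_class_UNIV[OF W] k ink K
  have cck: "ae W (\<lambda>x. cc_ultrafilter UNIV (k x))" by (rule ae_cc[OF W TK])
  obtain D where D: "cc_ultrafilter UNIV D"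
    and aeD: "\<And>P. ae D P \<longleftrightarrow> ae W (\<lambda>x. ae (k x) (\<lambda>y. P (opair x y)))"
    using sum_ultrafilter[OF W cck] by blast
  have monoW: "ae W P'" if "ae W P"
    "\<And>x. cc_ultrafilter UNIV (k x) \<Longrightarrow> P x \<Longrightarrow> P' x" for P P'
    using that cck ae_mono[OF W, of "\<lambda>x. cc_ultrafilter UNIV (k x) \<and> P x" P']
    by (simp add: ae_conj[OF W])
  \<comment> \<open>A function on pairs is read as a \<open>W\<close>-class of
    \<open>k x\<close>-classes. That \<open>\<rho>\<close> satisfies the collapse recursion for
    \<open>D\<close> makes it equal to \<open>cls D\<close> by \<open>cls_unique\<close>.\<close>
  define \<rho> where "\<rho> H = cls W (\<lambda>x. cls (k x) (\<lambda>y. H (opair x y)))" for H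
  \<comment> \<open>Surjectivity of \<open>\<rho>\<close> in the generality used for both members
    and the whole ultrapower: representatives chosen separately for each \<open>x\<close> are glued
    into one function \<open>H\<close> on pairs.\<close>
  have join: "cls W z \<in> \<rho> ` {G. ae D (\<lambda>p. Q (G p) p)}"
    if ex: "ae W (\<lambda>x. \<exists>G. z x = cls (k x) G \<and> ae (k x) (\<lambda>y. Q (G y) (opair x y)))" for z Q
  proof -
    obtain G where G: "ae W (\<lambda>x. z x = cls (k x) (G x) \<and> ae (k x) (\<lambda>y. Q (G x y) (opair x y)))"
      using ae_ex[OF W, THEN iffD1, OF ex] by blast
    define H where "H p = (THE z. \<exists>x y. p = opair x y \<and> z = G x y)" for p
    have H: "H (opair x y) = G x y" for x y by (simp add: H_def)
    have "cls W z = \<rho> H" unfolding \<rho>_def cls_eq_iff[OF W] H by (rule ae_mono[OF W G]) simp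
    moreover have "ae D (\<lambda>p. Q (H p) p)" unfolding aeD H by (rule ae_mono[OF W G]) simp
    ultimately show ?thesis by blast
  qed
  have cls_D: "cls D H = \<rho> H" for H
  proof (rule cls_unique[OF D], intro equalityI subsetI)
    fix H z assume "z \<in> elts (\<rho> H)"
    then obtain z' where z: "z = cls W z'"
      and z': "ae W (\<lambda>x. z' x \<in> elts (cls (k x) (\<lambda>y. H (opair x y))))"
      by (auto simp: \<rho>_def elts_cls[OF W])
    show "z \<in> \<rho> ` {G. ae D (\<lambda>p. G p \<in> elts (H p))}"
      unfolding z by (rule join[of z' "\<lambda>u p. u \<in> elts (H p)"], rule monoW[OF z'])
        (auto simp: elts_cls)
  next
    fix H z assume "z \<in> \<rho> ` {G. ae D (\<lambda>p. G p \<in> elts (H p))}"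
    then obtain G where z: "z = \<rho> G" and G: "ae D (\<lambda>p. G p \<in> elts (H p))" by blast
    show "z \<in> elts (\<rho> H)" unfolding z \<rho>_def cls_mem_iff[OF W]
      by (rule monoW[OF G[unfolded aeD]]) (simp add: cls_mem_iff)
  qed
  have "Ult (Ult UNIV W) K = uprod W (\<lambda>x. Ult UNIV (k x))"
    using los_Ult[OF W TK] by (simp add: los_class_def)
  also have "\<dots> = Ult UNIV D"
  proof (intro equalityI subsetI)
    fix z assume "z \<in> uprod W (\<lambda>x. Ult UNIV (k x))"
    then obtain z' where z: "z = cls W z'" and z': "ae W (\<lambda>x. z' x \<in> Ult UNIV (k x))"
      by (auto elim: uprodE[OF W])
    have "z \<in> \<rho> ` {G. ae D (\<lambda>p. True)}"
      unfolding z by (rule join[of z' "\<lambda>u p. True"], rule monoW[OF z'])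
        (auto simp: Ult_UNIV ae_const)
    then show "z \<in> Ult UNIV D" by (auto simp: Ult_UNIV[OF D] cls_D)
  next
    fix z assume "z \<in> Ult UNIV D"
    then obtain H where z: "z = \<rho> H" by (auto simp: Ult_UNIV[OF D] cls_D)
    show "z \<in> uprod W (\<lambda>x. Ult UNIV (k x))"
      unfolding z \<rho>_def cls_uprod_iff[OF W] by (rule ae_mono[OF W cck]) (simp add: Ult_UNIV)
  qed
  finally have Ult: "Ult (Ult UNIV W) K = Ult UNIV D" .
  have "ult_emb (Ult UNIV W) K (ult_emb UNIV W a) = ult_emb UNIV D a" for a
  proof -
    have "ult_emb (Ult UNIV W) K (ult_emb UNIV W a) = cls W (\<lambda>x. ult_emb UNIV (k x) a)"
      using los_ult_emb[OF W TK, of "\<lambda>_. a" "ult_emb UNIV W a"]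
      by (auto simp: los_elem_def ult_emb_UNIV[OF W] Ult_UNIV[OF W])
    also have "\<dots> = \<rho> (\<lambda>_. a)"
      unfolding \<rho>_def cls_eq_iff[OF W] by (rule ae_mono[OF W cck]) (simp add: ult_emb_UNIV)
    finally show ?thesis by (simp add: cls_D ult_emb_UNIV[OF D])
  qed
  then show ?thesis using D Ult by (auto simp: same_ult_def)
qed

lemma ae_inner_Ult:
  assumes "cc_ultrafilter UNIV U" "ae U (\<lambda>x. cc_ultrafilter UNIV (w x))"
  shows "ae U (\<lambda>x. inner (Ult UNIV (w x)))"
  by (rule ae_mono[OF assms]) (rule inner_Ult)

text \<open>\<open>iterated_ultrapower_UNIV\<close> holds at almost every point and lifts to
  \<open>M\<close>. Here the varying classes \<open>Ult UNIV (w x)\<close> occur, and the sum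
  ultrafilter obtained is an element of \<open>M\<close>.\<close>

lemma iterated_ultrapower:
  fixes U :: "'v::zfc"
  assumes U: "cc_ultrafilter UNIV U" and M: "M = Ult UNIV U"
    and W: "cc_ultrafilter M W" and K: "cc_ultrafilter (Ult M W) K"
  shows "\<exists>D\<in>M. same_ult M W K D"
proof -
  have M': "los_class U (\<lambda>_. UNIV) M" using los_class_UNIV[OF U] M by simp
  have ink: "ae U (\<lambda>_. inner UNIV)" by (simp add: ae_const[OF U] inner_UNIV)
  obtain w where w: "los_elem U w W" using cc_ultrafilter_mem[OF W] Ult_los_elem[OF U] M by blast
  note TW = M' w ink W
  have ccw: "ae U (\<lambda>x. cc_ultrafilter UNIV (w x))" by (rule ae_cc[OF U TW])
  note inw = ae_inner_Ult[OF U ccw]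
  have TN: "los_class U (\<lambda>x. Ult UNIV (w x)) (Ult M W)" by (rule los_Ult[OF U TW])
  obtain k where k: "los_elem U k K"
    using cc_ultrafilter_mem[OF K] los_class_subset_Ult[OF U TN] Ult_los_elem[OF U] by blast
  note TK = TN k inw K
  have cck: "ae U (\<lambda>x. cc_ultrafilter (Ult UNIV (w x)) (k x))" by (rule ae_cc[OF U TK])
  have "ae U (\<lambda>x. cc_ultrafilter UNIV (w x) \<and> cc_ultrafilter (Ult UNIV (w x)) (k x))"
    using ccw cck by (simp add: ae_conj[OF U])
  then have "ae U (\<lambda>x. \<exists>D\<in>UNIV. same_ult UNIV (w x) (k x) D)"
    by (rule ae_mono[OF U]) (use iterated_ultrapower_UNIV in blast)
  moreover have "los_prop U (\<lambda>x. \<exists>D\<in>UNIV. same_ult UNIV (w x) (k x) D) (\<exists>D\<in>M. same_ult M W K D)"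
    unfolding same_ult_def
    by (intro los[OF U] M' los_cc_ultrafilter[OF U] los_Ult[OF U TK] los_Ult[OF U _ _ ink] los_ult_emb[OF U TK]
        los_ult_emb[OF U _ _ ink] w W) (auto simp: M inner_Ult[OF U] intro!: ult_emb_Ult W[unfolded M])
  ultimately show ?thesis by (simp add: los_prop_def)
qed

section \<open>Agreement of internal ultrapower embeddings with a common target\<close>

definition bad :: "'v::zfc set \<Rightarrow> 'v \<Rightarrow> bool" where
  "bad M \<alpha> \<longleftrightarrow> (\<exists>E\<in>M. \<exists>E'\<in>M. cc_ultrafilter M E \<and> cc_ultrafilter M E' \<and> Ult M E = Ult M E' \<and>
     ult_emb M E \<alpha> \<noteq> ult_emb M E' \<alpha>)"

definition least_bad :: "'v::zfc set \<Rightarrow> 'v \<Rightarrow> bool" where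
  "least_bad M \<alpha> \<longleftrightarrow> ordinal \<alpha> \<and> bad M \<alpha> \<and> (\<forall>\<beta>\<in>elts \<alpha>. \<not> bad M \<beta>)"

lemma least_bad_unique: "least_bad M \<alpha> \<Longrightarrow> least_bad M \<beta> \<Longrightarrow> \<alpha> = \<beta>"
  using ordinal_linear[of \<alpha> \<beta>] by (auto simp: least_bad_def)

lemma los_bad:
  assumes U: "cc_ultrafilter UNIV U" and f: "los_elem U f y"
  shows "los_prop U (\<lambda>x. bad UNIV (f x)) (bad (Ult UNIV U) y)"
proof -
  have ink: "ae U (\<lambda>_. inner UNIV)" by (simp add: ae_const[OF U] inner_UNIV)
  show ?thesis unfolding bad_def
    by (intro los[OF U] los_class_UNIV[OF U] los_cc_ultrafilter[OF U] los_Ult[OF U _ _ ink]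
        los_ult_emb[OF U _ _ ink] f) (auto simp: los_elem_Ult[OF U f])
qed

lemma los_least_bad:
  assumes U: "cc_ultrafilter UNIV U" and f: "los_elem U f y"
  shows "los_prop U (\<lambda>x. least_bad UNIV (f x)) (least_bad (Ult UNIV U) y)"
  unfolding least_bad_def by (intro los[OF U] los_bad[OF U] los_ordinal[OF U] f)

text \<open>Otherwise the least bad ordinal is mapped by both embeddings to the least ordinal that is bad
  in the common ultrapower.\<close>

lemma not_bad:
  fixes \<alpha> :: "'v::zfc"
  shows "ordinal \<alpha> \<Longrightarrow> \<not> bad UNIV \<alpha>"
proof (induction \<alpha> rule: elts_induct)
  case (1 \<alpha>)
  show ?case
  proof
    assume "bad UNIV \<alpha>"
    then have lb: "least_bad UNIV \<alpha>"
      using 1 ordinal_mem by (auto simp: least_bad_def)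
    have lift: "least_bad (Ult UNIV E) (ult_emb UNIV E \<alpha>)" if E: "cc_ultrafilter UNIV E" for E
      using los_least_bad[OF E, of "\<lambda>_. \<alpha>" "ult_emb UNIV E \<alpha>"] lb
      by (simp add: los_prop_def los_elem_def ult_emb_UNIV[OF E] ae_const[OF E])
    show False using \<open>bad UNIV \<alpha>\<close> lift least_bad_unique unfolding bad_def by metis
  qed
qed

definition fin_ords :: "nat \<Rightarrow> 'v::zfc \<Rightarrow> bool" where
  "fin_ords n a \<longleftrightarrow> (\<forall>y\<in>elts a. ordinal y) \<and> finite (elts a) \<and> card (elts a) = n"

lemma los_fin_ords:
  assumes U: "cc_ultrafilter UNIV U" and f: "los_elem U f y"
  shows "los_prop U (\<lambda>x. fin_ords n (f x)) (fin_ords n y)"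
  unfolding fin_ords_def
  by (rule los_conj[OF U], intro los_ball[OF U] los_elts[OF U] f los_ordinal[OF U] los_cls, rule los_card[OF U f])

text \<open>Packaged as a single statement about \<open>M\<close>, so that the result for
  \<open>UNIV\<close> transfers to every \<open>Ult UNIV U\<close> in one application of
  Los.\<close>

definition embs_agree :: "nat \<Rightarrow> 'v::zfc set \<Rightarrow> bool" where
  "embs_agree n M \<longleftrightarrow> (\<forall>E\<in>M. \<forall>E'\<in>M. cc_ultrafilter M E \<and> cc_ultrafilter M E' \<and> Ult M E = Ult M E' \<longrightarrow>
     (\<forall>a\<in>M. fin_ords n a \<longrightarrow> ult_emb M E a = ult_emb M E' a))"

lemma embs_agree_UNIV: "embs_agree n (UNIV :: 'v::zfc set)"
proof -
  have "ult_emb UNIV E a = ult_emb UNIV E' a"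
    if E: "cc_ultrafilter UNIV E" "cc_ultrafilter UNIV E'" "Ult UNIV E = Ult UNIV E'"
      and a: "fin_ords n a" for E E' a :: 'v
  proof (rule extensionality)
    have "cls E (\<lambda>_. y) = cls E' (\<lambda>_. y)" if y: "y \<in> elts a" for y
    proof -
      have "\<not> bad UNIV y" by (rule not_bad) (use y a in \<open>simp add: fin_ords_def\<close>)
      then have "ult_emb UNIV E y = ult_emb UNIV E' y" using E unfolding bad_def by blast
      then show ?thesis by (simp add: ult_emb_UNIV E(1,2))
    qed
    then show "elts (ult_emb UNIV E a) = elts (ult_emb UNIV E' a)"
      using a by (simp add: ult_emb_UNIV E(1,2) cls_finite fin_ords_def cong: image_cong)
  qed
  then show ?thesis by (simp add: embs_agree_def)
qed

lemma embs_agree_Ult: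
  fixes U :: "'v::zfc"
  assumes U: "cc_ultrafilter UNIV U" shows "embs_agree n (Ult UNIV U)"
proof -
  have ink: "ae U (\<lambda>_. inner UNIV)" by (simp add: ae_const[OF U] inner_UNIV)
  have "los_prop U (\<lambda>_. embs_agree n (UNIV :: 'v set)) (embs_agree n (Ult UNIV U))"
    unfolding embs_agree_def
    by (intro los[OF U] los_class_UNIV[OF U] los_cc_ultrafilter[OF U] los_Ult[OF U _ _ ink]
        los_ult_emb[OF U _ _ ink] los_fin_ords[OF U]) auto
  then show ?thesis by (simp add: los_prop_def ae_const[OF U] embs_agree_UNIV)
qed

section \<open>Uniqueness\<close>

text \<open>The instances of elementarity on which derived ultrafilters depend: membership of the
  seed, its inclusion in the image of an ordinal, and its being a set of \<open>n\<close>
  ordinals.\<close>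

definition embs_elementary :: "nat \<Rightarrow> 'v::zfc set \<Rightarrow> bool" where
  "embs_elementary n M \<longleftrightarrow> (\<forall>W\<in>M. cc_ultrafilter M W \<longrightarrow> (\<forall>x\<in>M. \<forall>y\<in>M.
     (ult_emb M W x \<in> elts (ult_emb M W y) \<longleftrightarrow> x \<in> elts y) \<and>
     (elts (ult_emb M W x) \<subseteq> elts (ult_emb M W y) \<longleftrightarrow> elts x \<subseteq> elts y) \<and>
     (fin_ords n (ult_emb M W x) \<longleftrightarrow> fin_ords n x)))"

lemma embs_elementary_UNIV: "embs_elementary n (UNIV :: 'v::zfc set)"
proof -
  have "(cls W (\<lambda>_. x) \<in> elts (cls W (\<lambda>_. y)) \<longleftrightarrow> x \<in> elts y) \<and>
     (elts (cls W (\<lambda>_. x)) \<subseteq> elts (cls W (\<lambda>_. y)) \<longleftrightarrow> elts x \<subseteq> elts y) \<and>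
     (fin_ords n (cls W (\<lambda>_. x)) \<longleftrightarrow> fin_ords n x)"
    if W: "cc_ultrafilter UNIV W" for W x y :: 'v
    using los_subset[OF W los_elts[OF W los_cls[of W "\<lambda>_. x"]] los_elts[OF W los_cls[of W "\<lambda>_. y"]]]
      los_fin_ords[OF W los_cls[of W "\<lambda>_. x"], of n]
    by (simp add: cls_mem_iff[OF W] cls_eq_iff[OF W] ae_const[OF W] los_prop_def)
  then show ?thesis by (simp add: embs_elementary_def ult_emb_UNIV)
qed

lemma embs_elementary_Ult:
  fixes U :: "'v::zfc"
  assumes U: "cc_ultrafilter UNIV U" shows "embs_elementary n (Ult UNIV U)"
proof -
  have ink: "ae U (\<lambda>_. inner UNIV)" by (simp add: ae_const[OF U] inner_UNIV)
  have "los_prop U (\<lambda>_. embs_elementary n (UNIV :: 'v set)) (embs_elementary n (Ult UNIV U))"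
    unfolding embs_elementary_def
    by (intro los[OF U] los_class_UNIV[OF U] los_cc_ultrafilter[OF U] los_ult_emb[OF U _ _ ink]
        los_fin_ords[OF U]) auto
  then show ?thesis by (simp add: los_prop_def ae_const[OF U] embs_elementary_UNIV)
qed

lemma
  assumes "embs_elementary n M" "cc_ultrafilter M W" "x \<in> M"
  shows emb_mem_iff: "y \<in> M \<Longrightarrow> ult_emb M W x \<in> elts (ult_emb M W y) \<longleftrightarrow> x \<in> elts y"
    and emb_subset_iff: "y \<in> M \<Longrightarrow> elts (ult_emb M W x) \<subseteq> elts (ult_emb M W y) \<longleftrightarrow> elts x \<subseteq> elts y"
    and emb_fin_ords_iff: "fin_ords n (ult_emb M W x) \<longleftrightarrow> fin_ords n x"
  using assms cc_ultrafilter_mem[OF assms(2)] unfolding embs_elementary_def by blast+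

lemma emb_app:
  assumes U: "cc_ultrafilter UNIV U" and "is_fun_on f S" "a \<in> elts S"
  shows "ult_emb UNIV U (app f a) = app (ult_emb UNIV U f) (ult_emb UNIV U a)"
proof -
  have "is_fun_on (cls U (\<lambda>_. f)) (cls U (\<lambda>_. S))"
    using los_is_fun_on[OF U los_cls[of U "\<lambda>_. f"] los_cls[of U "\<lambda>_. S"]] assms
    by (simp add: los_prop_def ae_const[OF U])
  moreover have "cls U (\<lambda>_. a) \<in> elts (cls U (\<lambda>_. S))"
    using assms by (simp add: cls_mem_iff[OF U] ae_const[OF U])
  ultimately show ?thesis
    using los_app[OF U los_cls[of U "\<lambda>_. f"] los_cls[of U "\<lambda>_. a"] _ los_cls[of U "\<lambda>_. S"]]
    by (simp add: ult_emb_UNIV[OF U] los_elem_def)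
qed

text \<open>Every element of \<open>Ult UNIV U\<close> has the form \<open>j(f)([id])\<close>.\<close>

lemma ult_emb_determined:
  fixes U :: "'v::zfc"
  assumes U: "cc_ultrafilter UNIV U" and M: "M = Ult UNIV U"
    and E: "cc_ultrafilter M E" and E': "cc_ultrafilter M E'"
    and range: "\<And>f. ult_emb M E (ult_emb UNIV U f) = ult_emb M E' (ult_emb UNIV U f)"
    and id: "ult_emb M E (ult_id UNIV U) = ult_emb M E' (ult_id UNIV U)"
    and x: "x \<in> M"
  shows "ult_emb M E x = ult_emb M E' x"
proof -
  have ink: "ae U (\<lambda>_. inner UNIV)" by (simp add: ae_const[OF U] inner_UNIV)
  have TM: "los_class U (\<lambda>_. UNIV) M" using los_class_UNIV[OF U] M by simp
  obtain e e' where e: "los_elem U e E" and e': "los_elem U e' E'"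
    using Ult_los_elem[OF U] cc_ultrafilter_mem[OF E] cc_ultrafilter_mem[OF E'] M by blast
  note TE = TM e ink E and TE' = TM e' ink E'
  have emb: "ult_emb M E (cls U F) = cls U (\<lambda>x. ult_emb UNIV (e x) (F x))"
    "ult_emb M E' (cls U F) = cls U (\<lambda>x. ult_emb UNIV (e' x) (F x))" for F
    using los_ult_emb[OF U TE los_cls[of U F]] los_ult_emb[OF U TE' los_cls[of U F]]
    by (auto simp: los_elem_def M Ult_UNIV[OF U])
  obtain F where F: "x = cls U F" using x by (auto simp: M Ult_UNIV[OF U])
  \<comment> \<open>\<open>x\<close> is the value of the image of \<open>?f\<close> at
    \<open>[id]\<close>. Pointwise, the embeddings by \<open>e x\<close> and \<open>e' x\<close>
    agree at \<open>?f\<close> and at the point \<open>x\<close>, hence at the value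
    \<open>F x\<close>.\<close>
  let ?f = "lam (base U) F"
  have "ae U (\<lambda>x. ult_emb UNIV (e x) ?f = ult_emb UNIV (e' x) ?f \<and>
      ult_emb UNIV (e x) x = ult_emb UNIV (e' x) x \<and>
      cc_ultrafilter UNIV (e x) \<and> cc_ultrafilter UNIV (e' x))"
    using range[of ?f] id ae_cc[OF U TE] ae_cc[OF U TE']
    by (simp add: ult_emb_UNIV[OF U] ult_id_UNIV[OF U] emb cls_eq_iff[OF U] ae_conj[OF U])
  then have "ae U (\<lambda>x. ult_emb UNIV (e x) (F x) = ult_emb UNIV (e' x) (F x))"
  proof (rule ae_mono[OF U], elim conjE)
    fix x assume x: "x \<in> elts (base U)" and eq: "ult_emb UNIV (e x) ?f = ult_emb UNIV (e' x) ?f"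
      "ult_emb UNIV (e x) x = ult_emb UNIV (e' x) x"
      and cc: "cc_ultrafilter UNIV (e x)" "cc_ultrafilter UNIV (e' x)"
    have "ult_emb UNIV (e x) (app ?f x) = ult_emb UNIV (e' x) (app ?f x)"
      using emb_app[OF cc(1) is_fun_on_lam x] emb_app[OF cc(2) is_fun_on_lam x] eq by simp
    then show "ult_emb UNIV (e x) (F x) = ult_emb UNIV (e' x) (F x)" using x by simp
  qed
  then show ?thesis by (simp add: F emb cls_eq_iff[OF U])
qed

text \<open>Each composite is a single internal ultrapower embedding of \<open>M\<close>, by
  \<open>E\<close> and \<open>E'\<close>, and the targets coincide. So both agree on the seed, a
  finite set of ordinals, and \<open>ult_emb_determined\<close> extends this to all of
  \<open>M\<close>.\<close>

lemma factor_agree: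
  fixes U :: "'v::zfc"
  assumes U: "cc_ultrafilter UNIV U" and M: "M = Ult UNIV U" and id: "fin_ords n (ult_id UNIV U)"
    and W: "cc_ultrafilter M W" and W': "cc_ultrafilter M W'"
    and K: "cc_ultrafilter (Ult M W) K" and K': "cc_ultrafilter (Ult M W') K'"
    and Ult: "Ult (Ult M W) K = Ult (Ult M W') K'"
    and emb: "\<And>f. ult_emb (Ult M W) K (ult_emb M W (ult_emb UNIV U f)) =
      ult_emb (Ult M W') K' (ult_emb M W' (ult_emb UNIV U f))"
    and x: "x \<in> M"
  shows "ult_emb (Ult M W) K (ult_emb M W x) = ult_emb (Ult M W') K' (ult_emb M W' x)"
proof -
  obtain E where E: "E \<in> M" "same_ult M W K E" using iterated_ultrapower[OF U M W K] by blast
  obtain E' where E': "E' \<in> M" "same_ult M W' K' E'"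
    using iterated_ultrapower[OF U M W' K'] by blast
  have embM: "ult_emb UNIV U f \<in> M" for f
    using ult_emb_Ult[OF inner_UNIV U] by (simp add: M)
  have idM: "ult_id UNIV U \<in> M" using ult_id_Ult[OF inner_UNIV U] by (simp add: M)
  have cc: "cc_ultrafilter M E" "cc_ultrafilter M E'" using E E' by (simp_all add: same_ult_def)
  have comp: "ult_emb (Ult M W) K (ult_emb M W y) = ult_emb M E y"
    "ult_emb (Ult M W') K' (ult_emb M W' y) = ult_emb M E' y" if "y \<in> M" for y
    using E E' that by (simp_all add: same_ult_def)
  have "Ult M E = Ult M E'" using E E' Ult by (simp add: same_ult_def)
  then have "ult_emb M E (ult_id UNIV U) = ult_emb M E' (ult_id UNIV U)"
    using embs_agree_Ult[OF U, of n] cc E(1) E'(1) id idM unfolding embs_agree_def M[symmetric] by blast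
  then have "ult_emb M E x = ult_emb M E' x"
    by (intro ult_emb_determined[OF U M cc _ _ x]) (use emb comp embM in auto)
  then show ?thesis using comp x by simp
qed

text \<open>The further embeddings by \<open>K\<close> and \<open>K'\<close> identify the two seeds
  and the two embeddings of \<open>M\<close>, and by elementarity they preserve and reflect
  membership and inclusion. So both derivations have the same least ordinal and the same
  sets.\<close>

lemma derived_unique:
  assumes W: "is_derived M (ult_emb M W) b W" and W': "is_derived M (ult_emb M W') b' W'"
    and N: "embs_elementary n N" "cc_ultrafilter N K" "\<And>x. x \<in> M \<Longrightarrow> ult_emb M W x \<in> N" "b \<in> N"
    and N': "embs_elementary n N'" "cc_ultrafilter N' K'" "\<And>x. x \<in> M \<Longrightarrow> ult_emb M W' x \<in> N'" "b' \<in> N'"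
    and emb: "\<And>x. x \<in> M \<Longrightarrow> ult_emb N K (ult_emb M W x) = ult_emb N' K' (ult_emb M W' x)"
    and b: "ult_emb N K b = ult_emb N' K' b'" and card: "card (elts b) = card (elts b')"
  shows "W = W'"
proof -
  have mem: "b \<in> elts (ult_emb M W x) \<longleftrightarrow> b' \<in> elts (ult_emb M W' x)" if "x \<in> M" for x
    using emb_mem_iff[OF N(1,2,4) N(3)[OF that]] emb_mem_iff[OF N'(1,2,4) N'(3)[OF that]]
      emb[OF that] b by simp
  have sub: "elts b \<subseteq> elts (ult_emb M W x) \<longleftrightarrow> elts b' \<subseteq> elts (ult_emb M W' x)" if "x \<in> M" for x
    using emb_subset_iff[OF N(1,2,4) N(3)[OF that]] emb_subset_iff[OF N'(1,2,4) N'(3)[OF that]]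
      emb[OF that] b by simp
  obtain \<delta> where \<delta>: "\<delta> \<in> M" "ordinal \<delta>" "elts b \<subseteq> elts (ult_emb M W \<delta>)"
    "\<forall>\<beta>\<in>M. ordinal \<beta> \<and> elts b \<subseteq> elts (ult_emb M W \<beta>) \<longrightarrow> elts \<delta> \<subseteq> elts \<beta>"
    and eltsW: "elts W = {X \<in> M. elts X \<subseteq> elts (nsubsets \<delta> (card (elts b))) \<and> b \<in> elts (ult_emb M W X)}"
    using W unfolding is_derived_def by (elim bexE conjE) (rule that)
  obtain \<delta>' where \<delta>': "\<delta>' \<in> M" "ordinal \<delta>'" "elts b' \<subseteq> elts (ult_emb M W' \<delta>')"
    "\<forall>\<beta>\<in>M. ordinal \<beta> \<and> elts b' \<subseteq> elts (ult_emb M W' \<beta>) \<longrightarrow> elts \<delta>' \<subseteq> elts \<beta>"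
    and eltsW': "elts W' = {X \<in> M. elts X \<subseteq> elts (nsubsets \<delta>' (card (elts b'))) \<and> b' \<in> elts (ult_emb M W' X)}"
    using W' unfolding is_derived_def by (elim bexE conjE) (rule that)
  have "elts \<delta> \<subseteq> elts \<delta>'" using \<delta>(4) \<delta>'(1-3) sub by blast
  moreover have "elts \<delta>' \<subseteq> elts \<delta>" using \<delta>'(4) \<delta>(1-3) sub by blast
  ultimately have "\<delta> = \<delta>'" by (intro extensionality) simp
  then have "elts W = elts W'" unfolding eltsW eltsW' card using mem by auto
  then show ?thesis by (rule extensionality)
qed

lemma uniform_cc: "uniform_ultrafilter U \<Longrightarrow> cc_ultrafilter UNIV U"
  by (auto simp: uniform_ultrafilter_def cc_ultrafilter_def)

text \<open>Every point of the base is itself an \<open>n\<close>-element set of ordinals; by Los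
  the class of the identity is one too.\<close>

lemma uniform_fin_ords: 
  assumes "uniform_ultrafilter U" shows "\<exists>n. fin_ords n (ult_id UNIV U)"
proof -
  obtain \<kappa> n where \<kappa>: "ordinal \<kappa>" and U': "cc_ultrafilter_on UNIV (nsubsets \<kappa> n) U"
    using assms by (auto simp: uniform_ultrafilter_def)
  note U = uniform_cc[OF assms]
  have "base U = nsubsets \<kappa> n" using U' base_eq by (auto simp: cc_ultrafilter_on_def)
  then have "ae U (\<lambda>x. fin_ords n x)"
    by (intro ae_mono[OF U ae_base[OF U]]) (use \<kappa> ordinal_mem in \<open>auto simp: fin_ords_def\<close>)
  then show ?thesis using los_fin_ords[OF U los_cls[of U "\<lambda>x. x"], of n]
    by (auto simp: los_prop_def ult_id_UNIV[OF U])
qed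

lemma comparisonD:
  assumes "comparison U0 U1 W0 W1"
  shows "cc_ultrafilter (Ult UNIV U0) W0" "cc_ultrafilter (Ult UNIV U1) W1"
    "Ult (Ult UNIV U0) W0 = Ult (Ult UNIV U1) W1"
    "ult_emb (Ult UNIV U0) W0 (ult_emb UNIV U0 x) = ult_emb (Ult UNIV U1) W1 (ult_emb UNIV U1 x)"
  using assms unfolding comparison_def Let_def by (auto simp: fun_eq_iff)

lemma comparison_sym: "comparison U0 U1 W0 W1 \<Longrightarrow> comparison U1 U0 W1 W0"
  by (auto simp: comparison_def Let_def)

lemma canonical_unique_left:
  fixes U0 U1 :: "'v::zfc"
  assumes UA: "ultrapower_axiom TYPE('v)"
    and U: "uniform_ultrafilter U0" "uniform_ultrafilter U1"
    and can: "canonical_comparison U0 U1 W0 W1" and can': "canonical_comparison U0 U1 W0' W1'"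
  shows "W0 = W0'"
proof -
  note U0 = uniform_cc[OF U(1)] and U1 = uniform_cc[OF U(2)]
  define M0 M1 where M: "M0 = Ult UNIV U0" "M1 = Ult UNIV U1"
  define N N' where N: "N = Ult M0 W0" "N' = Ult M0 W0'"
  have "comparison U0 U1 W0 W1" "comparison U0 U1 W0' W1'"
    using can can' by (simp_all add: canonical_comparison_def)
  note c = comparisonD[OF this(1), folded M] and c' = comparisonD[OF this(2), folded M]
  have N1: "Ult M1 W1 = N" "Ult M1 W1' = N'" using c(3) c'(3) by (simp_all add: N)
  \<comment> \<open>Presenting the two targets as ultrapowers of the universe, by \<open>D\<close>
    and \<open>D'\<close>, makes the Ultrapower Axiom applicable to them.\<close>
  obtain D where D: "cc_ultrafilter UNIV D" "N = Ult UNIV D"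
    "\<And>x. ult_emb M0 W0 (ult_emb UNIV U0 x) = ult_emb UNIV D x"
    using iterated_ultrapower_UNIV[OF U0, folded M, OF c(1)] by (auto simp: same_ult_def N M)
  obtain D' where D': "cc_ultrafilter UNIV D'" "N' = Ult UNIV D'"
    "\<And>x. ult_emb M0 W0' (ult_emb UNIV U0 x) = ult_emb UNIV D' x"
    using iterated_ultrapower_UNIV[OF U0, folded M, OF c'(1)] by (auto simp: same_ult_def N M)
  obtain K K' where "comparison D D' K K'"
    using UA D(1) D'(1) unfolding ultrapower_axiom_def by blast
  note k = comparisonD[OF this, folded D(2) D'(2)]
  have D1: "ult_emb M1 W1 (ult_emb UNIV U1 x) = ult_emb UNIV D x"
    "ult_emb M1 W1' (ult_emb UNIV U1 x) = ult_emb UNIV D' x" for x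
    using c(4)[of x] c'(4)[of x] D(3)[of x] D'(3)[of x] by simp_all
  obtain n0 where n0: "fin_ords n0 (ult_id UNIV U0)" using uniform_fin_ords[OF U(1)] by blast
  obtain n where n: "fin_ords n (ult_id UNIV U1)" using uniform_fin_ords[OF U(2)] by blast
  have agree0: "ult_emb N K (ult_emb M0 W0 x) = ult_emb N' K' (ult_emb M0 W0' x)" if "x \<in> M0" for x
    unfolding N by (rule factor_agree[OF U0 M(1) n0 c(1) c'(1)])
      (use k D(3) D'(3) that in \<open>simp_all add: N\<close>)
  have agree1: "ult_emb N K (ult_emb M1 W1 x) = ult_emb N' K' (ult_emb M1 W1' x)" if "x \<in> M1" for x
    unfolding N1[symmetric] by (rule factor_agree[OF U1 M(2) n c(2) c'(2)])
      (use k D1 that in \<open>simp_all add: N1\<close>)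
  have inner: "inner M0" "inner M1" using inner_Ult U0 U1 by (simp_all add: M)
  have id: "ult_id UNIV U1 \<in> M1" using ult_id_Ult[OF inner_UNIV U1] by (simp add: M)
  define b b' where b: "b = ult_emb M1 W1 (ult_id UNIV U1)" "b' = ult_emb M1 W1' (ult_id UNIV U1)"
  have bN: "b \<in> N" "b' \<in> N'"
    using ult_emb_Ult[OF inner(2) c(2) id] ult_emb_Ult[OF inner(2) c'(2) id] by (simp_all add: b N1)
  have "fin_ords n b" "fin_ords n b'"
    using emb_fin_ords_iff[OF embs_elementary_Ult[OF U1, folded M(2)] _ id] c(2) c'(2) n
    by (simp_all add: b)
  then have card: "card (elts b) = card (elts b')" by (simp add: fin_ords_def)
  show ?thesis
  proof (rule derived_unique[where N = N and N' = N' and n = n and K = K and K' = K'])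
    show "is_derived M0 (ult_emb M0 W0) b W0" "is_derived M0 (ult_emb M0 W0') b' W0'"
      using can can' by (simp_all add: canonical_comparison_def M b Let_def)
    show "embs_elementary n N" "embs_elementary n N'"
      using embs_elementary_Ult D D' by simp_all
    show "ult_emb N K b = ult_emb N' K' b'" using agree1[OF id] by (simp add: b)
    show "ult_emb M0 W0 x \<in> N" "ult_emb M0 W0' x \<in> N'" if "x \<in> M0" for x
      using ult_emb_Ult[OF inner(1)] c(1) c'(1) that by (simp_all add: N)
  qed (use k bN card agree0 in simp_all)
qed

lemma canonical_comparison_sym:
  "canonical_comparison U0 U1 W0 W1 \<Longrightarrow> canonical_comparison U1 U0 W1 W0"
  by (auto simp: canonical_comparison_def Let_def comparison_sym)

section \<open>Existence\<close>

definition single_valued_set :: "'v::zfc \<Rightarrow> bool" where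
  "single_valued_set f \<longleftrightarrow> (\<forall>p\<in>elts f. \<forall>q\<in>elts f. \<forall>a y y'. p = opair a y \<longrightarrow> q = opair a y' \<longrightarrow> y = y')"

lemma single_valued_setD:
  "single_valued_set f \<Longrightarrow> opair a y \<in> elts f \<Longrightarrow> opair a y' \<in> elts f \<Longrightarrow> y = y'"
  unfolding single_valued_set_def by blast

lemma single_valued_setI:
  "(\<And>a y y'. opair a y \<in> elts f \<Longrightarrow> opair a y' \<in> elts f \<Longrightarrow> y = y') \<Longrightarrow> single_valued_set f"
  unfolding single_valued_set_def by blast

lemma los_single_valued_set:
  assumes U: "cc_ultrafilter UNIV U" and f: "los_elem U f f'"
  shows "los_prop U (\<lambda>x. single_valued_set (f x)) (single_valued_set f')"
proof -
  have *: "x \<in> Ult UNIV U \<and> y \<in> Ult UNIV U" if "cls U F = opair x y" for F x y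
    using opair_Ult[OF U, of x y] that Ult_UNIV[OF U] by (metis rangeI)
  show ?thesis unfolding single_valued_set_def
    by (intro los[OF U] los_elts[OF U] f los_all[OF U] los_opair[OF U]) (use * in blast)+
qed

text \<open>\<open>is_derived\<close> with a fixed number in place of \<open>card (elts a)\<close>:
  \<open>los_nsubsets\<close> lifts \<open>nsubsets\<close> for constant size, while
  \<open>card\<close> as a function does not lift.\<close>

definition is_derived_size :: "nat \<Rightarrow> 'v::zfc set \<Rightarrow> ('v \<Rightarrow> 'v) \<Rightarrow> 'v \<Rightarrow> 'v \<Rightarrow> bool" where
  "is_derived_size n M j a U \<longleftrightarrow> (\<exists>\<delta>\<in>M. ordinal \<delta> \<and> elts a \<subseteq> elts (j \<delta>) \<and>
     (\<forall>\<beta>\<in>M. ordinal \<beta> \<and> elts a \<subseteq> elts (j \<beta>) \<longrightarrow> elts \<delta> \<subseteq> elts \<beta>) \<and>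
     elts U = {X \<in> M. elts X \<subseteq> elts (nsubsets \<delta> n) \<and> a \<in> elts (j X)})"

text \<open>\<open>V\<close> is the ultrafilter derived from the embedding by \<open>W\<close> using \<open>b\<close>, and \<open>\<rho>\<close> is the factor
  embedding. Its range consists of the \<open>j\<^sub>W(f)(b)\<close>; stating this with single-valued
  relations \<open>f\<close> avoids mentioning their domains.\<close>

definition derived_factor ::
    "nat \<Rightarrow> 'v::zfc set \<Rightarrow> 'v \<Rightarrow> 'v \<Rightarrow> 'v \<Rightarrow> ('v \<Rightarrow> 'v) \<Rightarrow> bool" where
  "derived_factor n M W b V \<rho> \<longleftrightarrow> cc_ultrafilter M V \<and>
     fin_ords n (ult_id M V) \<and> is_derived_size n M (ult_emb M V) (ult_id M V) V \<and>
     (\<forall>y\<in>Ult M V. \<forall>z\<in>Ult M V. \<rho> y \<in> elts (\<rho> z) \<longleftrightarrow> y \<in> elts z) \<and>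
     \<rho> (ult_id M V) = b \<and> (\<forall>x\<in>M. \<rho> (ult_emb M V x) = ult_emb M W x) \<and>
     \<rho> ` Ult M V = {y \<in> Ult M W. \<exists>f\<in>M. single_valued_set f \<and> opair b y \<in> elts (ult_emb M W f)}"

lemma pushforward:
  fixes W S :: "'v::zfc"
  assumes W: "cc_ultrafilter UNIV W" and h: "ae W (\<lambda>t. h t \<in> elts S)"
    and V: "V = vset {X. elts X \<subseteq> elts S \<and> ae W (\<lambda>t. h t \<in> elts X)}"
  shows "cc_ultrafilter_on UNIV S V" and "base V = S" and "ae V P \<longleftrightarrow> ae W (\<lambda>t. P (h t))"
proof -
  have mono: "ae W (\<lambda>t. P' (h t))"
    if P: "ae W (\<lambda>t. P (h t))" and *: "\<And>x. x \<in> elts S \<Longrightarrow> P x \<Longrightarrow> P' x" for P P'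
  proof -
    have "ae W (\<lambda>t. h t \<in> elts S \<and> P (h t))" using h P by (simp add: ae_conj[OF W])
    then show ?thesis by (rule ae_mono[OF W]) (use * in auto)
  qed
  have conj: "ae W (\<lambda>t. P (h t) \<and> P' (h t))" if "ae W (\<lambda>t. P (h t))" "ae W (\<lambda>t. P' (h t))" for P P'
    using that by (simp add: ae_conj[OF W])
  have not_False: "\<not> ae W (\<lambda>t. False)" by (simp add: ae_const[OF W])
  have not: "ae W (\<lambda>t. P (h t)) \<or> ae W (\<lambda>t. \<not> P (h t))" for P by (simp add: ae_not[OF W])
  have omega: "ae W (\<lambda>t. \<forall>m\<in>elts omega. P m (h t))"
    if "\<And>m. m \<in> elts omega \<Longrightarrow> ae W (\<lambda>t. P m (h t))" for P :: "'v \<Rightarrow> 'v \<Rightarrow> bool"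
    using that by (rule ae_omega[OF W])
  show "cc_ultrafilter_on UNIV S V" "base V = S" "ae V P \<longleftrightarrow> ae W (\<lambda>t. P (h t))"
    by (rule cc_ultrafilter_quantifier[where Q = "\<lambda>P. ae W (\<lambda>t. P (h t))" and S = S and V = V];
        fact h mono conj not_False not omega V)+
qed

lemma ex_least_ordinal:
  assumes "ordinal \<alpha>" "P \<alpha>"
  shows "\<exists>\<delta>. ordinal \<delta> \<and> P \<delta> \<and> (\<forall>\<beta>\<in>elts \<delta>. \<not> P \<beta>)"
  using assms
proof (induction \<alpha> rule: elts_induct)
  case (1 \<alpha>)
  then show ?case using ordinal_mem[OF 1(2)] by blast
qed

lemma ex_ordinal_above:
  fixes X :: "'v::zfc set"
  assumes "small X" "\<And>x. x \<in> X \<Longrightarrow> ordinal x"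
  shows "\<exists>\<delta>. ordinal \<delta> \<and> X \<subseteq> elts \<delta>"
proof -
  define \<delta> where "\<delta> = vset (X \<union> (\<Union>x\<in>X. elts x))"
  have \<delta>: "elts \<delta> = X \<union> (\<Union>x\<in>X. elts x)"
    unfolding \<delta>_def by (intro elts_vset small_Un small_UN assms small_elts)
  have "ordinal y" if "y \<in> elts \<delta>" for y using that assms(2) ordinal_mem unfolding \<delta> by blast
  moreover have "elts y \<subseteq> elts \<delta>" if "y \<in> elts \<delta>" for y
    using that assms(2) unfolding \<delta> ordinal_def transset_def by blast
  ultimately have "ordinal \<delta>" by (auto simp: ordinal_def transset_def)
  then show ?thesis using \<delta> by blast
qed

text \<open>If \<open>b\<close> is the class of \<open>h\<close>, then \<open>V\<close> is the image
  of \<open>W\<close> under \<open>h\<close>, and the factor embedding sends the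
  \<open>V\<close>-class of \<open>F\<close> to the \<open>W\<close>-class of \<open>F\<close>
  composed with \<open>h\<close>.\<close>

lemma derived_factor_UNIV:
  fixes W :: "'v::zfc"
  assumes W: "cc_ultrafilter UNIV W" and b: "b \<in> Ult UNIV W" "fin_ords n b"
  shows "\<exists>V \<rho>. derived_factor n UNIV W b V \<rho>"
proof -
  obtain h where h: "b = cls W h" using b by (auto simp: Ult_UNIV[OF W])
  have hn: "ae W (\<lambda>t. fin_ords n (h t))"
    using los_fin_ords[OF W los_cls[of W h], of n] b(2) by (simp add: los_prop_def h)
  \<comment> \<open>A bound for all ordinals occurring in the \<open>h t\<close> guarantees that
    some ordinal almost always includes \<open>h t\<close>. The least such ordinal
    \<open>\<delta>\<close> is, by Los, the one demanded of a derived ultrafilter.\<close>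
  have "\<exists>\<alpha>. ordinal \<alpha> \<and> (\<Union>t\<in>elts (base W). {z \<in> elts (h t). ordinal z}) \<subseteq> elts \<alpha>"
    by (rule ex_ordinal_above) auto
  then obtain \<alpha> where \<alpha>: "ordinal \<alpha>" "\<And>t z. t \<in> elts (base W) \<Longrightarrow> z \<in> elts (h t) \<Longrightarrow> ordinal z \<Longrightarrow> z \<in> elts \<alpha>"
    by blast
  have "ae W (\<lambda>t. elts (h t) \<subseteq> elts \<alpha>)"
    by (rule ae_mono[OF W hn]) (use \<alpha> in \<open>auto simp: fin_ords_def\<close>)
  from ex_least_ordinal[of \<alpha> "\<lambda>\<alpha>. ae W (\<lambda>t. elts (h t) \<subseteq> elts \<alpha>)", OF \<alpha>(1) this]
  obtain \<delta> where \<delta>: "ordinal \<delta>" "ae W (\<lambda>t. elts (h t) \<subseteq> elts \<delta>)"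
    "\<forall>\<beta>\<in>elts \<delta>. \<not> ae W (\<lambda>t. elts (h t) \<subseteq> elts \<beta>)" by blast
  define S where "S = nsubsets \<delta> n"
  have "ae W (\<lambda>t. fin_ords n (h t) \<and> elts (h t) \<subseteq> elts \<delta>)" using hn \<delta> by (simp add: ae_conj[OF W])
  then have hS: "ae W (\<lambda>t. h t \<in> elts S)"
    by (rule ae_mono[OF W]) (auto simp: S_def fin_ords_def)
  define V where "V = vset {X. elts X \<subseteq> elts S \<and> ae W (\<lambda>t. h t \<in> elts X)}"
  note push = pushforward[OF W hS V_def]
  have V: "cc_ultrafilter UNIV V" using push(1) unfolding cc_ultrafilter_def by blast
  have "\<exists>\<rho>. \<forall>F. \<rho> (cls V F) = cls W (\<lambda>t. F (h t))"
    by (rule cls_lift[OF V]) (simp add: cls_eq_iff[OF W] push(3))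
  then obtain \<rho> where \<rho>: "\<And>F. \<rho> (cls V F) = cls W (\<lambda>t. F (h t))" by blast
  have "derived_factor n UNIV W b V \<rho>"
    unfolding derived_factor_def
  proof (intro conjI)
    show "cc_ultrafilter UNIV V" by (rule V)
    show "fin_ords n (ult_id UNIV V)"
      using los_fin_ords[OF V los_cls[of V "\<lambda>x. x"], of n] hn
      by (simp add: los_prop_def ult_id_UNIV[OF V] push(3))
    have sub: "elts (ult_id UNIV V) \<subseteq> elts (ult_emb UNIV V \<beta>) \<longleftrightarrow> ae W (\<lambda>t. elts (h t) \<subseteq> elts \<beta>)" for \<beta>
      using los_subset[OF V los_elts[OF V los_cls[of V "\<lambda>x. x"]] los_elts[OF V los_cls[of V "\<lambda>_. \<beta>"]]]
      by (simp add: los_prop_def ult_id_UNIV[OF V] ult_emb_UNIV[OF V] push(3))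
    have mem: "ult_id UNIV V \<in> elts (ult_emb UNIV V X) \<longleftrightarrow> ae W (\<lambda>t. h t \<in> elts X)" for X
      by (simp add: ult_id_UNIV[OF V] ult_emb_UNIV[OF V] push(3) cls_mem_iff[OF V])
    have "\<forall>\<beta>\<in>UNIV. ordinal \<beta> \<and> ae W (\<lambda>t. elts (h t) \<subseteq> elts \<beta>) \<longrightarrow> elts \<delta> \<subseteq> elts \<beta>"
      using \<delta> ordinal_not_mem_subset by blast
    moreover have "elts V = {X. elts X \<subseteq> elts S \<and> ae W (\<lambda>t. h t \<in> elts X)}"
      unfolding V_def by (rule elts_vset) simp
    ultimately show "is_derived_size n UNIV (ult_emb UNIV V) (ult_id UNIV V) V"
      unfolding is_derived_size_def sub mem
      by (intro bexI[of _ \<delta>] conjI) (use \<delta> in \<open>simp_all add: S_def\<close>)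
    show "\<forall>y\<in>Ult UNIV V. \<forall>z\<in>Ult UNIV V. \<rho> y \<in> elts (\<rho> z) \<longleftrightarrow> y \<in> elts z"
      by (auto simp: Ult_UNIV[OF V] \<rho> cls_mem_iff[OF W] cls_mem_iff[OF V] push(3))
    show "\<rho> (ult_id UNIV V) = b" by (simp add: ult_id_UNIV[OF V] \<rho> h)
    show "\<forall>x\<in>UNIV. \<rho> (ult_emb UNIV V x) = ult_emb UNIV W x"
      by (simp add: ult_emb_UNIV[OF V] ult_emb_UNIV[OF W] \<rho>)
    have opair: "opair b (cls W Y) \<in> elts (ult_emb UNIV W f) \<longleftrightarrow> ae W (\<lambda>t. opair (h t) (Y t) \<in> elts f)" for Y f
      using los_opair[OF W los_cls[of W h] los_cls[of W Y]]
      by (simp add: ult_emb_UNIV[OF W] cls_mem_iff[OF W] h los_elem_def)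
    show "\<rho> ` Ult UNIV V =
        {y \<in> Ult UNIV W. \<exists>f\<in>UNIV. single_valued_set f \<and> opair b y \<in> elts (ult_emb UNIV W f)}"
    proof (intro equalityI subsetI)
      fix y assume "y \<in> \<rho> ` Ult UNIV V"
      then obtain F where y: "y = cls W (\<lambda>t. F (h t))" by (auto simp: Ult_UNIV[OF V] \<rho>)
      have "single_valued_set (lam S F)" by (rule single_valued_setI) auto
      moreover have "opair b y \<in> elts (ult_emb UNIV W (lam S F))"
        unfolding y opair by (rule ae_mono[OF W hS]) simp
      ultimately show "y \<in> {y \<in> Ult UNIV W. \<exists>f\<in>UNIV. single_valued_set f \<and>
          opair b y \<in> elts (ult_emb UNIV W f)}"
        using y by (auto simp: Ult_UNIV[OF W])
    next
      fix y assume "y \<in> {y \<in> Ult UNIV W. \<exists>f\<in>UNIV. single_valued_set f \<and>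
          opair b y \<in> elts (ult_emb UNIV W f)}"
      then obtain Y f where y: "y = cls W Y" and f: "single_valued_set f"
        and Y: "ae W (\<lambda>t. opair (h t) (Y t) \<in> elts f)"
        by (auto simp: Ult_UNIV[OF W] opair)
      have "ae W (\<lambda>t. app f (h t) = Y t)"
        by (rule ae_mono[OF W Y]) (use single_valued_setD[OF f] in \<open>auto simp: app_def\<close>)
      then have "y = \<rho> (cls V (app f))" by (auto simp: y \<rho> cls_eq_iff[OF W] elim: ae_mono[OF W])
      then show "y \<in> \<rho> ` Ult UNIV V" by (auto simp: Ult_UNIV[OF V])
    qed
  qed
  then show ?thesis by blast
qed

text \<open>The construction in the universe is carried out at almost every \<open>x\<close>. Choice
  yields ultrafilters \<open>v x\<close> and factor maps \<open>k x\<close>; the latter are HOL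
  functions, not sets, and induce one map on the ultrapower by \<open>cls_lift\<close>.\<close>

lemma derived_factor_Ult:
  fixes U :: "'v::zfc"
  assumes U: "cc_ultrafilter UNIV U" and M: "M = Ult UNIV U"
    and W: "cc_ultrafilter M W" and b: "b \<in> Ult M W" "fin_ords n b"
  shows "\<exists>V \<rho>. derived_factor n M W b V \<rho>"
proof -
  have ink: "ae U (\<lambda>_. inner UNIV)" by (simp add: ae_const[OF U] inner_UNIV)
  have TM: "los_class U (\<lambda>_. UNIV) M" using los_class_UNIV[OF U] M by simp
  obtain w where w: "los_elem U w W" using Ult_los_elem[OF U] cc_ultrafilter_mem[OF W] M by blast
  note TW = TM w ink W
  note TN = los_Ult[OF U TW]
  obtain \<beta> where \<beta>: "los_elem U \<beta> b" using los_class_subset_Ult[OF U TN b(1)] Ult_los_elem[OF U] by blast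
  have "ae U (\<lambda>x. \<beta> x \<in> Ult UNIV (w x))"
    using los_mem[OF U \<beta> TN] b(1) by (simp add: los_prop_def)
  moreover have "ae U (\<lambda>x. fin_ords n (\<beta> x))"
    using los_fin_ords[OF U \<beta>] b(2) by (simp add: los_prop_def)
  ultimately have "ae U (\<lambda>x. cc_ultrafilter UNIV (w x) \<and> \<beta> x \<in> Ult UNIV (w x) \<and> fin_ords n (\<beta> x))"
    using ae_cc[OF U TW] by (simp add: ae_conj[OF U])
  then have "ae U (\<lambda>x. \<exists>V \<rho>. derived_factor n UNIV (w x) (\<beta> x) V \<rho>)"
    by (rule ae_mono[OF U]) (use derived_factor_UNIV in blast)
  then obtain v where "ae U (\<lambda>x. \<exists>\<rho>. derived_factor n UNIV (w x) (\<beta> x) (v x) \<rho>)"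
    using ae_ex[OF U, of "\<lambda>x V. \<exists>\<rho>. derived_factor n UNIV (w x) (\<beta> x) V \<rho>"] by blast
  then obtain k where k: "ae U (\<lambda>x. derived_factor n UNIV (w x) (\<beta> x) (v x) (k x))"
    using ae_ex[OF U, of "\<lambda>x. derived_factor n UNIV (w x) (\<beta> x) (v x)"] by blast
  have "\<exists>\<rho>. \<forall>F. \<rho> (cls U F) = cls U (\<lambda>x. k x (F x))"
    by (rule cls_lift[OF U]) (auto simp: cls_eq_iff[OF U] elim: ae_mono[OF U])
  then obtain \<rho> where \<rho>: "los_elem U (\<lambda>x. k x (F x)) (\<rho> (cls U F))" for F by (auto simp: los_elem_def)
  define V where "V = cls U v"
  have v: "los_elem U v V" by (simp add: los_elem_def V_def)
  have "ae U (\<lambda>x. cc_ultrafilter UNIV (v x))"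
    by (rule ae_mono[OF U k]) (simp add: derived_factor_def)
  then have V: "cc_ultrafilter M V" using los_cc_ultrafilter[OF U TM v] by (simp add: los_prop_def)
  note TV = TM v ink V
  have \<rho>': "los_elem U (\<lambda>x. k x (f x)) (\<rho> y)" if "los_elem U f y" for f y using that \<rho>[of f] by (simp add: los_elem_def)
  have der: "los_prop U (\<lambda>x. is_derived_size n UNIV (ult_emb UNIV (v x)) (ult_id UNIV (v x)) (v x))
      (is_derived_size n M (ult_emb M V) (ult_id M V) V)"
    unfolding is_derived_size_def
    by (intro los[OF U] TM los_ordinal[OF U] los_ult_emb[OF U TV] los_ult_id[OF U TV] los_nsubsets[OF U] v)
  have "los_prop U (\<lambda>x. derived_factor n UNIV (w x) (\<beta> x) (v x) (k x)) (derived_factor n M W b V \<rho>)"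
    unfolding derived_factor_def
    by (intro los[OF U] der \<rho>' TM TN los_Ult[OF U TV] los_ult_emb[OF U TV] los_ult_emb[OF U TW]
        los_ult_id[OF U TV] los_fin_ords[OF U] los_cc_ultrafilter[OF U] los_single_valued_set[OF U]
        los_opair[OF U] v w \<beta>)
  then show ?thesis using k by (auto simp: los_prop_def)
qed

section \<open>Hulls generated by the range of an embedding and two seeds\<close>

definition ofst :: "'v::zfc \<Rightarrow> 'v" where "ofst p = (THE a. \<exists>b. p = opair a b)"
definition osnd :: "'v::zfc \<Rightarrow> 'v" where "osnd p = (THE b. \<exists>a. p = opair a b)"

lemma ofst_opair [simp]: "ofst (opair a b) = a" and osnd_opair [simp]: "osnd (opair a b) = b"
  by (simp_all add: ofst_def osnd_def)

text \<open>Uncurrying a family of relations \<open>G x\<close> into one set \<open>f\<close> of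
  triples; \<open>ex_section\<close> goes back, and \<open>ex_swapped\<close> exchanges the two
  arguments.\<close>

lemma ex_curried:
  fixes G :: "'v::zfc \<Rightarrow> 'v"
  shows "\<exists>f. \<forall>x c z. opair (opair x c) z \<in> elts f \<longleftrightarrow> x \<in> elts S \<and> opair c z \<in> elts (G x)"
proof -
  define X where "X = (\<Union>x\<in>elts S. (\<lambda>u. opair (opair x (ofst u)) (osnd u)) `
    {u. u \<in> elts (G x) \<and> (\<exists>c z. u = opair c z)})"
  have "small X" unfolding X_def by (intro small_UN small_image small_Collect_conj small_elts)
  moreover have "opair (opair x c) z \<in> X \<longleftrightarrow> x \<in> elts S \<and> opair c z \<in> elts (G x)" for x c z
    by (force simp: X_def)
  ultimately show ?thesis by (intro exI[of _ "vset X"]) simp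
qed

lemma ex_section:
  fixes f x :: "'v::zfc"
  shows "\<exists>g. \<forall>c z. opair c z \<in> elts g \<longleftrightarrow> opair (opair x c) z \<in> elts f"
proof -
  define X where "X = (\<lambda>u. opair (osnd (ofst u)) (osnd u)) `
    {u. u \<in> elts f \<and> (\<exists>c z. u = opair (opair x c) z)}"
  have "small X" unfolding X_def by (intro small_image small_Collect_conj)
  moreover have "opair c z \<in> X \<longleftrightarrow> opair (opair x c) z \<in> elts f" for c z
    by (force simp: X_def)
  ultimately show ?thesis by (intro exI[of _ "vset X"]) simp
qed

lemma ex_swapped:
  fixes f :: "'v::zfc"
  shows "\<exists>g. \<forall>x c z. opair (opair c x) z \<in> elts g \<longleftrightarrow> opair (opair x c) z \<in> elts f"
proof -
  define X where "X = (\<lambda>u. opair (opair (osnd (ofst u)) (ofst (ofst u))) (osnd u)) `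
    {u. u \<in> elts f \<and> (\<exists>x c z. u = opair (opair x c) z)}"
  have "small X" unfolding X_def by (intro small_image small_Collect_conj)
  moreover have "opair (opair c x) z \<in> X \<longleftrightarrow> opair (opair x c) z \<in> elts f" for x c z
    by (force simp: X_def)
  ultimately show ?thesis by (intro exI[of _ "vset X"]) simp
qed

text \<open>The values \<open>j(f)(a, b)\<close>, with \<open>f\<close> again a single-valued relation.\<close>

definition hull2 :: "('v::zfc \<Rightarrow> 'v) \<Rightarrow> 'v \<Rightarrow> 'v \<Rightarrow> 'v set" where
  "hull2 j a b = {y. \<exists>f. (\<forall>x c z z'. opair (opair x c) z \<in> elts f \<longrightarrow> opair (opair x c) z' \<in> elts f \<longrightarrow> z = z') \<and>
     opair (opair a b) y \<in> elts (j f)}"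

lemma hull2_swap_subset:
  assumes D: "cc_ultrafilter UNIV D" and ab: "a \<in> Ult UNIV D" "b \<in> Ult UNIV D"
  shows "Ult UNIV D \<inter> hull2 (ult_emb UNIV D) a b \<subseteq> hull2 (ult_emb UNIV D) b a"
proof
  fix y assume y: "y \<in> Ult UNIV D \<inter> hull2 (ult_emb UNIV D) a b"
  then obtain f where f: "\<And>x c z z'. opair (opair x c) z \<in> elts f \<Longrightarrow> opair (opair x c) z' \<in> elts f \<Longrightarrow> z = z'"
    "opair (opair a b) y \<in> elts (ult_emb UNIV D f)"
    unfolding hull2_def by blast
  obtain g where g: "\<And>x c z. opair (opair c x) z \<in> elts g \<longleftrightarrow> opair (opair x c) z \<in> elts f"
    using ex_swapped[of f] by blast
  obtain \<alpha> \<beta> \<eta> where los_elem: "los_elem D \<alpha> a" "los_elem D \<beta> b" "los_elem D \<eta> y"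
    using Ult_los_elem[OF D] ab y by blast
  have fTb: "los_prop D (\<lambda>t. opair (opair (\<alpha> t) (\<beta> t)) (\<eta> t) \<in> elts f)
      (opair (opair a b) y \<in> elts (ult_emb UNIV D f))"
    unfolding ult_emb_UNIV[OF D] by (intro los[OF D] los_opair[OF D] los_elem)
  have gTb: "los_prop D (\<lambda>t. opair (opair (\<beta> t) (\<alpha> t)) (\<eta> t) \<in> elts g)
      (opair (opair b a) y \<in> elts (ult_emb UNIV D g))"
    unfolding ult_emb_UNIV[OF D] by (intro los[OF D] los_opair[OF D] los_elem)
  have "opair (opair b a) y \<in> elts (ult_emb UNIV D g)"
    using fTb gTb f(2) by (simp add: los_prop_def g)
  then show "y \<in> hull2 (ult_emb UNIV D) b a" unfolding hull2_def using f(1) g by blast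
qed

lemma hull2_swap:
  assumes D: "cc_ultrafilter UNIV D" and ab: "a \<in> Ult UNIV D" "b \<in> Ult UNIV D"
  shows "Ult UNIV D \<inter> hull2 (ult_emb UNIV D) a b = Ult UNIV D \<inter> hull2 (ult_emb UNIV D) b a"
  using hull2_swap_subset[OF D ab] hull2_swap_subset[OF D ab(2,1)] by blast

text \<open>In terms of functions: applying the image of the class of \<open>G\<close> to
  \<open>b\<close> is applying the image of \<open>f\<close> to the pair of the
  \<open>U\<close>-seed and \<open>b\<close>, when almost every \<open>G x\<close> is the section of
  \<open>f\<close> at \<open>x\<close>. Los is used twice, for \<open>w x\<close> at almost every
  \<open>x\<close> and then for \<open>U\<close>.\<close>

lemma curried_mem_iff:
  fixes U :: "'v::zfc"
  assumes U: "cc_ultrafilter UNIV U" and M: "M = Ult UNIV U"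
    and W: "cc_ultrafilter M W" and b: "b \<in> Ult M W" and y: "y \<in> Ult M W"
    and G: "ae U (\<lambda>x. \<forall>c z. opair c z \<in> elts (G x) \<longleftrightarrow> opair (opair x c) z \<in> elts f)"
  shows "opair b y \<in> elts (ult_emb M W (cls U G)) \<longleftrightarrow>
    opair (opair (ult_emb M W (ult_id UNIV U)) b) y \<in> elts (ult_emb M W (ult_emb UNIV U f))"
proof -
  have ink: "ae U (\<lambda>_. inner UNIV)" by (simp add: ae_const[OF U] inner_UNIV)
  have TM: "los_class U (\<lambda>_. UNIV) M" using los_class_UNIV[OF U] M by simp
  obtain w where w: "los_elem U w W" using Ult_los_elem[OF U] cc_ultrafilter_mem[OF W] M by blast
  note TW = TM w ink W
  note TN = los_Ult[OF U TW]
  obtain \<beta> \<eta> where los_elem: "los_elem U \<beta> b" "los_elem U \<eta> y"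
    using los_class_subset_Ult[OF U TN] b y Ult_los_elem[OF U] by blast
  have clsM: "cls U F \<in> M" for F by (simp add: M Ult_UNIV[OF U])
  have "ae U (\<lambda>x. \<beta> x \<in> Ult UNIV (w x))" "ae U (\<lambda>x. \<eta> x \<in> Ult UNIV (w x))"
    using los_mem[OF U los_elem(1) TN] los_mem[OF U los_elem(2) TN] b y by (simp_all add: los_prop_def)
  with G ae_cc[OF U TW] have "ae U (\<lambda>x. cc_ultrafilter UNIV (w x) \<and>
      (\<beta> x \<in> Ult UNIV (w x) \<and> \<eta> x \<in> Ult UNIV (w x)) \<and>
      (\<forall>c z. opair c z \<in> elts (G x) \<longleftrightarrow> opair (opair x c) z \<in> elts f))"
    by (subst ae_conj[OF U] ae_conj[OF U])+ blast
  then have "ae U (\<lambda>x. opair (\<beta> x) (\<eta> x) \<in> elts (ult_emb UNIV (w x) (G x)) \<longleftrightarrow>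
      opair (opair (ult_emb UNIV (w x) x) (\<beta> x)) (\<eta> x) \<in> elts (ult_emb UNIV (w x) f))"
  proof (rule ae_mono[OF U], elim conjE)
    fix x assume w: "cc_ultrafilter UNIV (w x)" and "\<beta> x \<in> Ult UNIV (w x)" "\<eta> x \<in> Ult UNIV (w x)"
      and G: "\<forall>c z. opair c z \<in> elts (G x) \<longleftrightarrow> opair (opair x c) z \<in> elts f"
    then obtain B Y where BY: "los_elem (w x) B (\<beta> x)" "los_elem (w x) Y (\<eta> x)" using Ult_los_elem[OF w] by blast
    have "los_prop (w x) (\<lambda>t. opair (B t) (Y t) \<in> elts (G x))
        (opair (\<beta> x) (\<eta> x) \<in> elts (ult_emb UNIV (w x) (G x)))"
      unfolding ult_emb_UNIV[OF w] by (intro los[OF w] los_opair[OF w] BY)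
    moreover have "los_prop (w x) (\<lambda>t. opair (opair x (B t)) (Y t) \<in> elts f)
        (opair (opair (ult_emb UNIV (w x) x) (\<beta> x)) (\<eta> x) \<in> elts (ult_emb UNIV (w x) f))"
      unfolding ult_emb_UNIV[OF w] by (intro los[OF w] los_opair[OF w] BY)
    ultimately show "opair (\<beta> x) (\<eta> x) \<in> elts (ult_emb UNIV (w x) (G x)) \<longleftrightarrow>
      opair (opair (ult_emb UNIV (w x) x) (\<beta> x)) (\<eta> x) \<in> elts (ult_emb UNIV (w x) f)"
      using G by (simp add: los_prop_def)
  qed
  moreover have "los_prop U (\<lambda>x. opair (\<beta> x) (\<eta> x) \<in> elts (ult_emb UNIV (w x) (G x)))
      (opair b y \<in> elts (ult_emb M W (cls U G)))"
    by (intro los[OF U] los_opair[OF U] los_elem los_ult_emb[OF U TW] clsM)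
  moreover have "los_prop U (\<lambda>x. opair (opair (ult_emb UNIV (w x) x) (\<beta> x)) (\<eta> x) \<in> elts (ult_emb UNIV (w x) f))
      (opair (opair (ult_emb M W (ult_id UNIV U)) b) y \<in> elts (ult_emb M W (ult_emb UNIV U f)))"
    unfolding ult_emb_UNIV[OF U] ult_id_UNIV[OF U]
    by (intro los[OF U] los_opair[OF U] los_elem los_ult_emb[OF U TW] clsM)
  ultimately show ?thesis by (simp add: los_prop_def ae_iff[OF U])
qed

text \<open>Currying: since \<open>M\<close> is generated by the range of \<open>j\<^sub>U\<close> and \<open>[id]\<^sub>U\<close>, the hull of
  \<open>b\<close> and the range of \<open>j\<^sub>W\<close> is symmetric in the two seeds.\<close>

lemma hull_eq_hull2:
  fixes U :: "'v::zfc"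
  assumes U: "cc_ultrafilter UNIV U" and M: "M = Ult UNIV U"
    and W: "cc_ultrafilter M W" and b: "b \<in> Ult M W"
  shows "{y \<in> Ult M W. \<exists>f\<in>M. single_valued_set f \<and> opair b y \<in> elts (ult_emb M W f)} =
    Ult M W \<inter> hull2 (\<lambda>f. ult_emb M W (ult_emb UNIV U f)) (ult_emb M W (ult_id UNIV U)) b"
proof (intro equalityI subsetI)
  fix y assume "y \<in> {y \<in> Ult M W. \<exists>f\<in>M. single_valued_set f \<and> opair b y \<in> elts (ult_emb M W f)}"
  then obtain G where y: "y \<in> Ult M W" "opair b y \<in> elts (ult_emb M W (cls U G))"
    and G: "single_valued_set (cls U G)" by (auto simp: M Ult_UNIV[OF U])
  have aeG: "ae U (\<lambda>x. single_valued_set (G x))"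
    using los_single_valued_set[OF U los_cls[of U G]] G by (simp add: los_prop_def)
  \<comment> \<open>The sections are single-valued only almost everywhere; emptying the others makes
    \<open>f\<close> single-valued everywhere, as \<open>hull2\<close> requires.\<close>
  let ?G = "\<lambda>x. if single_valued_set (G x) then G x else vset {}"
  obtain f where f: "\<And>x c z. opair (opair x c) z \<in> elts f \<longleftrightarrow> x \<in> elts (base U) \<and> opair c z \<in> elts (?G x)"
    using ex_curried[of "base U" ?G] by blast
  have "ae U (\<lambda>x. \<forall>c z. opair c z \<in> elts (G x) \<longleftrightarrow> opair (opair x c) z \<in> elts f)"
    by (rule ae_mono[OF U aeG]) (simp add: f)
  note iff = curried_mem_iff[OF U M W b y(1) this]
  have "z = z'" if "opair (opair x c) z \<in> elts f" "opair (opair x c) z' \<in> elts f" for x c z z'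
    using that unfolding f by (cases "single_valued_set (G x)") (auto dest: single_valued_setD)
  then show "y \<in> Ult M W \<inter> hull2 (\<lambda>f. ult_emb M W (ult_emb UNIV U f)) (ult_emb M W (ult_id UNIV U)) b"
    unfolding hull2_def using y iff by blast
next
  fix y assume "y \<in> Ult M W \<inter> hull2 (\<lambda>f. ult_emb M W (ult_emb UNIV U f)) (ult_emb M W (ult_id UNIV U)) b"
  then obtain f where y: "y \<in> Ult M W"
    "opair (opair (ult_emb M W (ult_id UNIV U)) b) y \<in> elts (ult_emb M W (ult_emb UNIV U f))"
    and f: "\<And>x c z z'. opair (opair x c) z \<in> elts f \<Longrightarrow> opair (opair x c) z' \<in> elts f \<Longrightarrow> z = z'"
    unfolding hull2_def by blast
  have "\<exists>G. \<forall>x c z. opair c z \<in> elts (G x) \<longleftrightarrow> opair (opair x c) z \<in> elts f"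
    using ex_section[of _ f] by (intro choice) blast
  then obtain G where G: "\<And>x c z. opair c z \<in> elts (G x) \<longleftrightarrow> opair (opair x c) z \<in> elts f" by blast
  have "single_valued_set (G x)" for x by (rule single_valued_setI) (use f G in blast)
  then have "single_valued_set (cls U G)"
    using los_single_valued_set[OF U los_cls[of U G]] by (simp add: los_prop_def ae_const[OF U])
  moreover have "opair b y \<in> elts (ult_emb M W (cls U G))"
    using curried_mem_iff[OF U M W b y(1), of G f] y(2) by (simp add: G ae_const[OF U])
  moreover have "cls U G \<in> M" by (simp add: M Ult_UNIV[OF U])
  ultimately show "y \<in> {y \<in> Ult M W. \<exists>f\<in>M. single_valued_set f \<and> opair b y \<in> elts (ult_emb M W f)}"
    using y(1) by blast
qed

text \<open>Both \<open>A\<close> and \<open>B\<close> are the transitive collapse of the common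
  range, and \<open>f\<close> and \<open>g\<close> invert the collapsing map.\<close>

lemma transitive_collapse_unique:
  fixes A B :: "'v::zfc set"
  assumes transA: "\<And>x y. x \<in> A \<Longrightarrow> y \<in> elts x \<Longrightarrow> y \<in> A"
    and transB: "\<And>x y. x \<in> B \<Longrightarrow> y \<in> elts x \<Longrightarrow> y \<in> B"
    and f: "\<forall>x\<in>A. \<forall>y\<in>A. f x \<in> elts (f y) \<longleftrightarrow> x \<in> elts y"
    and g: "\<forall>x\<in>B. \<forall>y\<in>B. g x \<in> elts (g y) \<longleftrightarrow> x \<in> elts y"
    and range: "f ` A = g ` B"
  shows "x \<in> A \<Longrightarrow> x \<in> B \<and> g x = f x"
proof (induction x rule: elts_induct)
  case (1 a)
  obtain b where b: "b \<in> B" "f a = g b" using range 1(2) by blast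
  have "c \<in> elts b" if c: "c \<in> elts a" for c
  proof -
    have "c \<in> A" "c \<in> B" "g c = f c" using 1 c transA by blast+
    then show ?thesis using f g b c 1(2) by metis
  qed
  moreover have "c \<in> elts a" if c: "c \<in> elts b" for c
  proof -
    have cB: "c \<in> B" using transB b c by blast
    then obtain d where d: "d \<in> A" "g c = f d" using range by blast
    have da: "d \<in> elts a" using f g b c cB d 1(2) by metis
    then have dB: "d \<in> B" "g d = g c" using 1 d by auto
    \<comment> \<open>\<open>g\<close> is injective on the transitive class \<open>B\<close>: the
      members of a point of \<open>B\<close> are the points of \<open>B\<close> whose images lie in
      its image.\<close>
    have "c = d"
    proof (rule extensionality)
      show "elts c = elts d" using g transB cB dB by (metis subsetI subset_antisym)
    qed
    then show ?thesis using da by simp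
  qed
  ultimately have "b = a" by (intro extensionality) blast
  then show ?case using b by simp
qed

lemma derived_factor_is_derived:
  assumes "derived_factor n M W b V \<rho>"
  shows "is_derived M (ult_emb M V) (ult_id M V) V"
proof -
  have "card (elts (ult_id M V)) = n" "is_derived_size n M (ult_emb M V) (ult_id M V) V"
    using assms by (simp_all add: derived_factor_def fin_ords_def)
  then show ?thesis by (simp add: is_derived_size_def is_derived_def)
qed

lemma canonical_exists:
  fixes U0 U1 :: "'v::zfc"
  assumes UA: "ultrapower_axiom TYPE('v)"
    and U: "uniform_ultrafilter U0" "uniform_ultrafilter U1"
  shows "\<exists>W0 W1. canonical_comparison U0 U1 W0 W1"
proof -
  note U0 = uniform_cc[OF U(1)] and U1 = uniform_cc[OF U(2)]
  define M0 M1 where M: "M0 = Ult UNIV U0" "M1 = Ult UNIV U1"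
  obtain E0 E1 where "comparison U0 U1 E0 E1"
    using UA U0 U1 unfolding ultrapower_axiom_def by blast
  note E = comparisonD[OF this, folded M]
  define N where N: "N = Ult M0 E0"
  have N1: "Ult M1 E1 = N" using E(3) by (simp add: N)
  obtain D where D: "cc_ultrafilter UNIV D" "N = Ult UNIV D"
    and embD0: "\<And>x. ult_emb M0 E0 (ult_emb UNIV U0 x) = ult_emb UNIV D x"
    using iterated_ultrapower_UNIV[OF U0, folded M, OF E(1)] by (auto simp: same_ult_def N M)
  have embD1: "ult_emb M1 E1 (ult_emb UNIV U1 x) = ult_emb UNIV D x" for x
    using E(4)[of x] embD0[of x] by simp
  have inner: "inner M0" "inner M1" using inner_Ult U0 U1 by (simp_all add: M)
  have id: "ult_id UNIV U0 \<in> M0" "ult_id UNIV U1 \<in> M1"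
    using ult_id_Ult[OF inner_UNIV] U0 U1 by (simp_all add: M)
  define b0 b1 where b: "b0 = ult_emb M0 E0 (ult_id UNIV U0)" "b1 = ult_emb M1 E1 (ult_id UNIV U1)"
  have bN: "b0 \<in> N" "b1 \<in> N"
    using ult_emb_Ult[OF inner(1) E(1) id(1)] ult_emb_Ult[OF inner(2) E(2) id(2)]
    by (simp_all add: b N1 N[symmetric])
  obtain n0 n1 where "fin_ords n0 (ult_id UNIV U0)" "fin_ords n1 (ult_id UNIV U1)"
    using uniform_fin_ords U by blast
  then have fin: "fin_ords n0 b0" "fin_ords n1 b1"
    using emb_fin_ords_iff[OF embs_elementary_Ult[OF U0, folded M(1)] E(1) id(1)]
      emb_fin_ords_iff[OF embs_elementary_Ult[OF U1, folded M(2)] E(2) id(2)]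
    by (simp_all add: b)
  \<comment> \<open>The indices cross over: \<open>W0\<close> is derived using \<open>b1\<close>,
    the image of the seed of \<open>U1\<close>, and \<open>W1\<close> using
    \<open>b0\<close>.\<close>
  obtain W0 k0 where k0: "derived_factor n1 M0 E0 b1 W0 k0"
    using derived_factor_Ult[OF U0 M(1) E(1) bN(2)[unfolded N] fin(2)] by blast
  obtain W1 k1 where k1: "derived_factor n0 M1 E1 b0 W1 k1"
    using derived_factor_Ult[OF U1 M(2) E(2) bN(1)[folded N1] fin(1)] by blast
  note k = k0[unfolded derived_factor_def] k1[unfolded derived_factor_def]
  have cc: "cc_ultrafilter M0 W0" "cc_ultrafilter M1 W1" using k by blast+
  \<comment> \<open>Both composites into \<open>N\<close> equal the embedding by \<open>D\<close>,
    so the two ranges are hulls over the same embedding and differ only in the order of the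
    seeds.\<close>
  have "k0 ` Ult M0 W0 = N \<inter> hull2 (ult_emb UNIV D) b0 b1"
    using k(1) hull_eq_hull2[OF U0 M(1) E(1) bN(2)[unfolded N]]
    by (simp add: embD0 N[symmetric] b(1)[symmetric])
  moreover have "k1 ` Ult M1 W1 = N \<inter> hull2 (ult_emb UNIV D) b1 b0"
    using k(2) hull_eq_hull2[OF U1 M(2) E(2) bN(1)[folded N1]]
    by (simp add: embD1 N1 b(2)[symmetric])
  ultimately have range: "k0 ` Ult M0 W0 = k1 ` Ult M1 W1"
    using hull2_swap[OF D(1)] bN by (simp add: D(2))
  \<comment> \<open>Seen as ultrapowers of the universe, both new targets are transitive, so the
    collapse argument applies to \<open>k0\<close> and \<open>k1\<close>.\<close>
  obtain D0 D1 where D01: "cc_ultrafilter UNIV D0" "Ult M0 W0 = Ult UNIV D0"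
    "cc_ultrafilter UNIV D1" "Ult M1 W1 = Ult UNIV D1"
    using iterated_ultrapower_UNIV[OF U0, folded M, OF cc(1)]
      iterated_ultrapower_UNIV[OF U1, folded M, OF cc(2)] by (auto simp: same_ult_def M)
  have trans: "y \<in> Ult M0 W0" if "x \<in> Ult M0 W0" "y \<in> elts x" for x y
    using Ult_trans[OF D01(1)] that D01(2) by simp
  have trans': "y \<in> Ult M1 W1" if "x \<in> Ult M1 W1" "y \<in> elts x" for x y
    using Ult_trans[OF D01(3)] that D01(4) by simp
  have mem: "\<forall>x\<in>Ult M0 W0. \<forall>y\<in>Ult M0 W0. k0 x \<in> elts (k0 y) \<longleftrightarrow> x \<in> elts y"
    "\<forall>x\<in>Ult M1 W1. \<forall>y\<in>Ult M1 W1. k1 x \<in> elts (k1 y) \<longleftrightarrow> x \<in> elts y"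
    by (rule k[THEN conjunct2, THEN conjunct2, THEN conjunct2, THEN conjunct1])+
  have k01: "x \<in> Ult M1 W1 \<and> k1 x = k0 x" if "x \<in> Ult M0 W0" for x
    by (rule transitive_collapse_unique[OF trans trans' mem range that])
  have k10: "x \<in> Ult M0 W0 \<and> k0 x = k1 x" if "x \<in> Ult M1 W1" for x
    by (rule transitive_collapse_unique[OF trans' trans mem(2,1) range[symmetric] that])
  have Ult: "Ult M0 W0 = Ult M1 W1" using k01 k10 by blast
  have inj: "x = y" if "x \<in> Ult M0 W0" "y \<in> Ult M0 W0" "k0 x = k0 y" for x y
  proof (rule extensionality)
    show "elts x = elts y" using mem(1) trans that by (metis subsetI subset_antisym)
  qed
  have emb: "ult_emb UNIV U0 x \<in> M0" "ult_emb UNIV U1 x \<in> M1" for x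
    using ult_emb_Ult[OF inner_UNIV] U0 U1 by (simp_all add: M)
  have in_Ult: "y \<in> M0 \<Longrightarrow> ult_emb M0 W0 y \<in> Ult M0 W0" "z \<in> M1 \<Longrightarrow> ult_emb M1 W1 z \<in> Ult M0 W0" for y z
    using ult_emb_Ult[OF inner(1) cc(1)] ult_emb_Ult[OF inner(2) cc(2)] by (simp_all add: Ult)
  have k0_emb: "k0 (ult_emb M0 W0 y) = ult_emb M0 E0 y" if "y \<in> M0" for y using k(1) that by blast
  have k1_emb: "k0 (ult_emb M1 W1 z) = ult_emb M1 E1 z" if "z \<in> M1" for z
    using k(2) that k01 in_Ult(2) by metis
  have "ult_emb M0 W0 (ult_emb UNIV U0 x) = ult_emb M1 W1 (ult_emb UNIV U1 x)" for x
    by (rule inj) (simp_all add: in_Ult emb k0_emb k1_emb E(4))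
  then have comp: "comparison U0 U1 W0 W1"
    using cc cc_ultrafilter_mem Ult by (auto simp: comparison_def Let_def M[symmetric])
  \<comment> \<open>The injective \<open>k0\<close> sends both sides to \<open>b1\<close>. Hence
    being derived using \<open>[id]\<close> is being derived using the image of the other seed, as
    canonicity demands.\<close>
  have id0: "ult_id M0 W0 = ult_emb M1 W1 (ult_id UNIV U1)"
  proof (rule inj)
    show "ult_id M0 W0 \<in> Ult M0 W0" by (rule ult_id_Ult[OF inner(1) cc(1)])
    show "k0 (ult_id M0 W0) = k0 (ult_emb M1 W1 (ult_id UNIV U1))"
      using k(1) by (simp add: k1_emb id b)
  qed (simp add: in_Ult id)
  have id1: "ult_id M1 W1 = ult_emb M0 W0 (ult_id UNIV U0)"
  proof (rule inj)
    show "ult_id M1 W1 \<in> Ult M0 W0" using ult_id_Ult[OF inner(2) cc(2)] Ult by simp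
    then show "k0 (ult_id M1 W1) = k0 (ult_emb M0 W0 (ult_id UNIV U0))"
      using k(2) k01[of "ult_id M1 W1"] by (simp add: k0_emb id b)
  qed (simp add: in_Ult id)
  note derived_factor_is_derived[OF k0] derived_factor_is_derived[OF k1]
  then have "canonical_comparison U0 U1 W0 W1"
    using comp id0 id1 by (simp add: canonical_comparison_def M[symmetric])
  then show ?thesis by blast
qed

theorem theorem4p5:
  fixes U0 U1 :: "'v :: zfc"
  assumes "ultrapower_axiom TYPE('v)"
    and "uniform_ultrafilter U0" and "uniform_ultrafilter U1"
  shows "\<exists>!W. canonical_comparison U0 U1 (fst W) (snd W)"
proof -
  obtain W0 W1 where W: "canonical_comparison U0 U1 W0 W1"
    using canonical_exists[OF assms] by blast
  show ?thesis
  proof (rule ex1I[of _ "(W0, W1)"])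
    show "canonical_comparison U0 U1 (fst (W0, W1)) (snd (W0, W1))" using W by simp
  next
    fix V assume V: "canonical_comparison U0 U1 (fst V) (snd V)"
    have "fst V = W0" by (rule canonical_unique_left[OF assms V W])
    moreover have "snd V = W1"
      by (rule canonical_unique_left[OF assms(1,3,2) V[THEN canonical_comparison_sym]
            W[THEN canonical_comparison_sym]])
    ultimately show "V = (W0, W1)" by (simp add: prod_eq_iff)
  qed
qed

end
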